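(* Let $k\in\mathbb N$ and let $\mathcal S\subseteq\mathcal G_k$ be a subset consisting of (marked $k$-generated) acylindrically hyperbolic groups. Let $\overline{\mathcal S}$ denote the closure of $\mathcal S$ in $\mathcal G_k$. Then being topologizable is a generic property in $\overline{\mathcal S}$, i.e. there is a dense $G_\delta$ subset of the space $\overline{\mathcal S}$ all of whose elements are topologizable groups.
   Context: Let $F_k$ be the free group with basis $X=\{x_1,\ldots,x_k\}$ and let $\mathcal G_k$ be the set of all normal subgroups of $F_k$, with the (ultra)metric $\mathrm d(M,N)=\max\{1/|w| : w\in M\vartriangle N\}$ if $M\neq N$ and $\mathrm d(M,M)=0$, where $|\cdot|$ is word length with respect to $X$. One identifies $\mathcal G_k$ with the set of marked $k$-generated groups, i.e. pairs $(G,(x_1,\ldots,x_k))$ where $G$ is a group and $(x_1,\ldots,x_k)$ is a generating $k$-tuple of $G$ ($N\lhd F_k$ corresponds to $F_k/N$ with the images of the basis elements). A subset of a topological space is a $G_\delta$ set if it is an intersection of countably many open sets. A property is generic in a topological space $Y$ if it holds for every element of some dense $G_\delta$ subset of $Y$. A group is topologizable if it admits a non-discrete Hausdorff group topology. An isometric action of a group $G$ on a metric space $S$ is acylindrical if for every $\varepsilon>0$ there exist $R,N>0$ such that for every two points $x,y\in S$ with $\mathrm d(x,y)\ge R$ there are at most $N$ elements $g\in G$ satisfying $\mathrm d(x,gx)\le\varepsilon$ and $\mathrm d(y,gy)\le\varepsilon$. A group $G$ is acylindrically hyperbolic if it admits a non-elementary acylindrical isometric action on a Gromov hyperbolic space;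 here non-elementary means that $G$ is not virtually cyclic and the action has unbounded orbits. *)

theory Defs
  imports "HOL-Analysis.Analysis" "HOL-Algebra.Group_Action" "HOL-Algebra.Generated_Groups"
begin

section \<open>The free group of rank k\<close>

text \<open>
  The letter \<open>(i, True)\<close> stands for the basis element with index \<open>i < k\<close> and
  \<open>(i, False)\<close> for its inverse. The free group is realised by reduced words, so that
  the word length with respect to the basis is the length of the list.
\<close>

type_synonym letter = "nat \<times> bool"
type_synonym word = "letter list"

definition inv_letter :: "letter \<Rightarrow> letter" where
  "inv_letter a = (fst a, \<not> snd a)"

definition reduced_word :: "word \<Rightarrow> bool" where
  "reduced_word w \<longleftrightarrow> successively (\<lambda>a b. b \<noteq> inv_letter a) w"

fun cons_red :: "letter \<Rightarrow> word \<Rightarrow> word" where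
  "cons_red a [] = [a]"
| "cons_red a (b # w) = (if b = inv_letter a then w else a # b # w)"

definition reduce :: "word \<Rightarrow> word" where
  "reduce w = foldr cons_red w []"

definition free_group :: "nat \<Rightarrow> word monoid" where
  "free_group k =
     \<lparr>carrier = {w. reduced_word w \<and> set w \<subseteq> {..<k} \<times> UNIV},
      mult = (\<lambda>u v. reduce (u @ v)),
      one = []\<rparr>"

lemma inv_letter_invol [simp]: "inv_letter (inv_letter a) = a"
  by (simp add: inv_letter_def)

lemma inv_letter_neq [simp]: "inv_letter a \<noteq> a" "a \<noteq> inv_letter a"
  by (cases a; simp add: inv_letter_def)+

lemma reduced_Nil [simp]: "reduced_word []"
  by (simp add: reduced_word_def)

lemma reduced_Cons:
  "reduced_word (a # w) \<longleftrightarrow> reduced_word w \<and> (w = [] \<or> hd w \<noteq> inv_letter a)"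
  by (auto simp: reduced_word_def successively_Cons)

lemma reduced_cons_red: "reduced_word w \<Longrightarrow> reduced_word (cons_red a w)"
  by (cases w) (auto simp: reduced_Cons)

lemma cons_red_reduced: "reduced_word (a # w) \<Longrightarrow> cons_red a w = a # w"
  by (cases w) (auto simp: reduced_Cons)

lemma cons_red_cancel: "reduced_word w \<Longrightarrow> cons_red a (cons_red (inv_letter a) w) = w"
  by (cases w) (auto simp: reduced_Cons cons_red_reduced)

lemma reduced_foldr: "reduced_word w \<Longrightarrow> reduced_word (foldr cons_red u w)"
  by (induction u) (auto intro: reduced_cons_red)

lemma reduced_reduce: "reduced_word (reduce w)"
  by (simp add: reduce_def reduced_foldr)

lemma reduce_reduced: "reduced_word w \<Longrightarrow> reduce w = w"
proof (induction w)
  case (Cons a w)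
  then show ?case
    using cons_red_reduced[of a w] by (simp add: reduce_def reduced_Cons)
qed (simp add: reduce_def)

lemma reduce_append: "reduced_word v \<Longrightarrow> reduce (u @ v) = foldr cons_red u v"
  using reduce_reduced[of v] by (simp add: reduce_def)

lemma foldr_cons_red:
  assumes "reduced_word v" "reduced_word w"
  shows "foldr cons_red (cons_red a v) w = cons_red a (foldr cons_red v w)"
proof (cases v)
  case (Cons b v')
  show ?thesis
  proof (cases "b = inv_letter a")
    case True
    have "reduced_word (foldr cons_red v' w)"
      using assms by (simp add: reduced_foldr)
    then show ?thesis
      using True Cons by (simp add: cons_red_cancel)
  qed (use Cons in simp)
qed simp

lemma foldr_foldr:
  assumes "reduced_word v" "reduced_word w"
  shows "foldr cons_red (foldr cons_red u v) w = foldr cons_red u (foldr cons_red v w)"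
  using assms by (induction u) (auto simp: foldr_cons_red reduced_foldr)

lemma set_cons_red: "set (cons_red a w) \<subseteq> insert a (set w)"
  by (cases w) auto

lemma set_reduce: "set (reduce w) \<subseteq> set w"
  using set_cons_red by (induction w) (fastforce simp: reduce_def)+

lemma foldr_inv_word:
  "reduced_word w \<Longrightarrow> foldr cons_red (rev (map inv_letter u)) (foldr cons_red u w) = w"
proof (induction u)
  case (Cons a u)
  have "reduced_word (foldr cons_red u w)"
    using Cons.prems by (simp add: reduced_foldr)
  then show ?case
    using Cons cons_red_cancel[of "foldr cons_red u w" "inv_letter a"] by simp
qed simp

lemma group_free_group: "group (free_group k)"
proof (rule groupI)
  fix u v assume "u \<in> carrier (free_group k)" "v \<in> carrier (free_group k)"
  then show "u \<otimes>\<^bsub>free_group k\<^esub> v \<in> carrier (free_group k)"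
    using set_reduce[of "u @ v"] by (fastforce simp: free_group_def reduced_reduce)
next
  fix u v w
  assume "u \<in> carrier (free_group k)" "v \<in> carrier (free_group k)"
    "w \<in> carrier (free_group k)"
  then have "reduced_word u" "reduced_word v" "reduced_word w"
    by (auto simp: free_group_def)
  then show "u \<otimes>\<^bsub>free_group k\<^esub> v \<otimes>\<^bsub>free_group k\<^esub> w =
      u \<otimes>\<^bsub>free_group k\<^esub> (v \<otimes>\<^bsub>free_group k\<^esub> w)"
    by (simp add: free_group_def reduce_append reduced_foldr foldr_foldr)
next
  fix u assume u: "u \<in> carrier (free_group k)"
  define v where "v = reduce (rev (map inv_letter u))"
  have red: "reduced_word u"
    using u by (simp add: free_group_def)
  have "set v \<subseteq> inv_letter ` set u"
    using set_reduce[of "rev (map inv_letter u)"] by (simp add: v_def)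
  also have "\<dots> \<subseteq> {..<k} \<times> UNIV"
    using u by (auto simp: free_group_def inv_letter_def)
  finally have "v \<in> carrier (free_group k)"
    by (simp add: v_def free_group_def reduced_reduce)
  moreover have "v \<otimes>\<^bsub>free_group k\<^esub> u = []"
    using foldr_foldr[of "[]" u "rev (map inv_letter u)"] foldr_inv_word[of "[]" u]
      reduce_reduced[OF red] red
    by (simp add: v_def free_group_def reduce_append reduce_def)
  ultimately show "\<exists>v\<in>carrier (free_group k). v \<otimes>\<^bsub>free_group k\<^esub> u = \<one>\<^bsub>free_group k\<^esub>"
    by (auto simp: free_group_def)
qed (auto simp: free_group_def reduce_reduced)


section \<open>The space of marked groups\<close>

definition marked_groups :: "nat \<Rightarrow> word set set" where
  "marked_groups k = {N. N \<lhd> free_group k}"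

text \<open>
  The maximum below exists whenever \<open>M \<noteq> N\<close>. For normal subgroups the empty word never lies
  in the symmetric difference, so there is no division by zero.
\<close>

definition marked_dist :: "word set \<Rightarrow> word set \<Rightarrow> real" where
  "marked_dist M N =
     (if M = N then 0
      else GREATEST r. r \<in> (\<lambda>w. 1 / real (length w)) ` sym_diff M N)"

lemma marked_dist_greatest:
  assumes "M \<noteq> N"
  obtains w where "w \<in> sym_diff M N" "marked_dist M N = 1 / real (length w)"
    "\<And>v. v \<in> sym_diff M N \<Longrightarrow> 1 / real (length v) \<le> marked_dist M N"
proof -
  let ?D = "sym_diff M N"
  have "\<exists>w\<in>?D. \<forall>v\<in>?D. 1 / real (length v) \<le> 1 / real (length w)"
  proof (cases "\<exists>w\<in>?D. w \<noteq> []")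
    case True
    then obtain w where w: "w \<in> ?D" "w \<noteq> []"
      and min: "\<And>v. v \<in> ?D \<Longrightarrow> v \<noteq> [] \<Longrightarrow> length w \<le> length v"
      using ex_has_least_nat[of "\<lambda>w. w \<in> ?D \<and> w \<noteq> []" _ length] by blast
    have "1 / real (length v) \<le> 1 / real (length w)" if "v \<in> ?D" for v
      using min[OF that] w by (cases "v = []") (auto intro: divide_left_mono)
    then show ?thesis
      using w by blast
  next
    case False
    moreover have "?D \<noteq> {}"
      using assms by blast
    ultimately show ?thesis
      by (metis all_not_in_conv order_refl)
  qed
  then obtain w where w: "w \<in> ?D"
    and max: "\<And>v. v \<in> ?D \<Longrightarrow> 1 / real (length v) \<le> 1 / real (length w)"
    by blast
  have "marked_dist M N = 1 / real (length w)"
    unfolding marked_dist_def using assms w max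
    by (auto intro!: Greatest_equality)
  then show ?thesis
    using that w max by simp
qed

lemma marked_dist_nonneg: "0 \<le> marked_dist M N"
proof (cases "M = N")
  case False
  then show ?thesis
    by (rule marked_dist_greatest) simp
qed (simp add: marked_dist_def)

lemma Nil_in_marked_group: "N \<in> marked_groups k \<Longrightarrow> [] \<in> N"
  using subgroup.one_closed[of N "free_group k"]
  by (auto simp: marked_groups_def normal_def free_group_def)

lemma Metric_space_marked_groups: "Metric_space (marked_groups k) marked_dist"
proof
  show "0 \<le> marked_dist M N" for M N
    by (rule marked_dist_nonneg)
  show "marked_dist M N = marked_dist N M" for M N
    by (simp add: marked_dist_def Un_commute eq_commute)
next
  fix M N assume "M \<in> marked_groups k" "N \<in> marked_groups k"
  then have no_Nil: "[] \<notin> sym_diff M N"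
    using Nil_in_marked_group by blast
  show "marked_dist M N = 0 \<longleftrightarrow> M = N"
  proof
    show "M = N" if "marked_dist M N = 0"
    proof (rule ccontr)
      assume "M \<noteq> N"
      then obtain w where "w \<in> sym_diff M N" "marked_dist M N = 1 / real (length w)"
        by (rule marked_dist_greatest)
      then show False
        using no_Nil that by auto
    qed
  qed (simp add: marked_dist_def)
next
  fix L M N
  show "marked_dist L N \<le> marked_dist L M + marked_dist M N"
  proof (cases "L = N")
    case True
    then show ?thesis
      using marked_dist_nonneg[of L M] marked_dist_nonneg[of M N]
      by (simp add: marked_dist_def)
  next
    case False
    then obtain w where w: "w \<in> sym_diff L N" "marked_dist L N = 1 / real (length w)"
      by (rule marked_dist_greatest)
    have le: "1 / real (length w) \<le> marked_dist A B" if "w \<in> sym_diff A B" for A B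
    proof -
      have "A \<noteq> B"
        using that by blast
      then show ?thesis
        by (rule marked_dist_greatest) (use that in blast)
    qed
    have "w \<in> sym_diff L M \<or> w \<in> sym_diff M N"
      using w(1) by blast
    then have "marked_dist L N \<le> marked_dist L M \<or> marked_dist L N \<le> marked_dist M N"
      using le w(2) by metis
    then show ?thesis
      using marked_dist_nonneg[of L M] marked_dist_nonneg[of M N] by linarith
  qed
qed

definition marked_topology :: "nat \<Rightarrow> word set topology" where
  "marked_topology k = Metric_space.mtopology (marked_groups k) marked_dist"


section \<open>Generic properties and topologizable groups\<close>

definition generic_in :: "'a topology \<Rightarrow> ('a \<Rightarrow> bool) \<Rightarrow> bool" where
  "generic_in Y P \<longleftrightarrow>
     (\<exists>D. gdelta_in Y D \<and> Y closure_of D = topspace Y \<and> (\<forall>x\<in>D. P x))"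

definition group_topology :: "('a, 'b) monoid_scheme \<Rightarrow> 'a topology \<Rightarrow> bool" where
  "group_topology G T \<longleftrightarrow>
     topspace T = carrier G \<and>
     continuous_map (prod_topology T T) T (\<lambda>(x, y). x \<otimes>\<^bsub>G\<^esub> y) \<and>
     continuous_map T T (\<lambda>x. inv\<^bsub>G\<^esub> x)"

definition topologizable :: "('a, 'b) monoid_scheme \<Rightarrow> bool" where
  "topologizable G \<longleftrightarrow>
     (\<exists>T. group_topology G T \<and> Hausdorff_space T \<and> T \<noteq> discrete_topology (carrier G))"


section \<open>Acylindrically hyperbolic groups\<close>

definition geodesic_segment ::
    "'s set \<Rightarrow> ('s \<Rightarrow> 's \<Rightarrow> real) \<Rightarrow> 's \<Rightarrow> 's \<Rightarrow> 's set \<Rightarrow> bool" where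
  "geodesic_segment S d x y A \<longleftrightarrow>
     (\<exists>l p. 0 \<le> l \<and> p ` {0..l} \<subseteq> S \<and> p 0 = x \<and> p l = y \<and>
        (\<forall>s\<in>{0..l}. \<forall>t\<in>{0..l}. d (p s) (p t) = \<bar>s - t\<bar>) \<and> A = p ` {0..l})"

text \<open>
  Hyperbolic spaces are geodesic by definition. This cannot be dropped: with hyperbolicity
  expressed by Gromov products on arbitrary metric spaces, every infinite finitely generated
  group that is not virtually cyclic would be acylindrically hyperbolic, by its action on itself
  with the metric \<open>log (1 + d)\<close> for a word metric \<open>d\<close>.
\<close>

definition gromov_hyperbolic :: "'s set \<Rightarrow> ('s \<Rightarrow> 's \<Rightarrow> real) \<Rightarrow> bool" where
  "gromov_hyperbolic S d \<longleftrightarrow>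
     Metric_space S d \<and>
     (\<forall>x\<in>S. \<forall>y\<in>S. \<exists>A. geodesic_segment S d x y A) \<and>
     (\<exists>\<delta>. \<forall>x y z A B C.
        geodesic_segment S d x y A \<longrightarrow> geodesic_segment S d y z B \<longrightarrow>
        geodesic_segment S d x z C \<longrightarrow>
        (\<forall>p\<in>A. \<exists>q\<in>B \<union> C. d p q \<le> \<delta>))"

definition isometric_action ::
    "('a, 'b) monoid_scheme \<Rightarrow> 's set \<Rightarrow> ('s \<Rightarrow> 's \<Rightarrow> real) \<Rightarrow> ('a \<Rightarrow> 's \<Rightarrow> 's) \<Rightarrow> bool" where
  "isometric_action G S d \<phi> \<longleftrightarrow>
     group_action G S \<phi> \<and>
     (\<forall>g\<in>carrier G. \<forall>x\<in>S. \<forall>y\<in>S. d (\<phi> g x) (\<phi> g y) = d x y)"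

definition acylindrical ::
    "('a, 'b) monoid_scheme \<Rightarrow> 's set \<Rightarrow> ('s \<Rightarrow> 's \<Rightarrow> real) \<Rightarrow> ('a \<Rightarrow> 's \<Rightarrow> 's) \<Rightarrow> bool" where
  "acylindrical G S d \<phi> \<longleftrightarrow>
     (\<forall>\<epsilon>>0. \<exists>R>0. \<exists>N::nat. N > 0 \<and>
        (\<forall>x\<in>S. \<forall>y\<in>S. d x y \<ge> R \<longrightarrow>
           finite {g \<in> carrier G. d x (\<phi> g x) \<le> \<epsilon> \<and> d y (\<phi> g y) \<le> \<epsilon>} \<and>
           card {g \<in> carrier G. d x (\<phi> g x) \<le> \<epsilon> \<and> d y (\<phi> g y) \<le> \<epsilon>} \<le> N))"

definition virtually_cyclic :: "('a, 'b) monoid_scheme \<Rightarrow> bool" where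
  "virtually_cyclic G \<longleftrightarrow> (\<exists>x\<in>carrier G. finite (rcosets\<^bsub>G\<^esub> (generate G {x})))"

definition non_elementary ::
    "('a, 'b) monoid_scheme \<Rightarrow> 's set \<Rightarrow> ('s \<Rightarrow> 's \<Rightarrow> real) \<Rightarrow> ('a \<Rightarrow> 's \<Rightarrow> 's) \<Rightarrow> bool" where
  "non_elementary G S d \<phi> \<longleftrightarrow>
     \<not> virtually_cyclic G \<and> (\<forall>x\<in>S. \<not> Metric_space.mbounded S d (orbit G \<phi> x))"

text \<open>
  HOL cannot quantify over all metric spaces inside a formula; the type argument says in which
  type the points of the space are taken. For countable groups
  every type of at least continuum size gives the same notion, since every such action restricts to an
  invariant geodesic subspace with at most continuum many points.
\<close>

definition acylindrically_hyperbolic ::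
    "'s itself \<Rightarrow> ('a, 'b) monoid_scheme \<Rightarrow> bool" where
  "acylindrically_hyperbolic _ G \<longleftrightarrow>
     (\<exists>(S :: 's set) d \<phi>.
        S \<noteq> {} \<and> gromov_hyperbolic S d \<and> isometric_action G S d \<phi> \<and>
        acylindrical G S d \<phi> \<and> non_elementary G S d \<phi>)"

end

theory Submission
  imports Defs
begin

text \<open>
  A word over a group \<open>G\<close> in a variable \<open>X\<close> can be evaluated at every element of \<open>G\<close>. Call
  \<open>g \<noteq> 1\<close> evasive for a set of words if every word of the set that does not vanish at \<open>1\<close> does
  not vanish at \<open>g\<close> either. The proof is built on this notion, in three steps.

  If a group with a length function has, for every \<open>K\<close>, an element that is evasive for all words
  of complexity at most \<open>K\<close>, then it is topologizable (\<open>topologizable_if_evasive\<close>). This is the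
  harder half of Markov's criterion for countable groups. Choose a sequence \<open>g\<^sub>n\<close> of elements that
  are evasive for quickly growing complexities, give a conjugate of \<open>g\<^sub>n\<close> or of its inverse by
  \<open>a\<close> the cost \<open>2 ^ (|a| - n)\<close>, and let the norm of \<open>x\<close> be the least total cost of a
  factorisation of \<open>x\<close> into such conjugates, cut off at \<open>1\<close>. Then \<open>g\<^sub>n\<close> tends to \<open>1\<close>, and the
  norm has trivial kernel: in a cheap factorisation of \<open>x\<close> the factors of the largest index can be
  dropped by evasiveness, again and again, until the empty product remains.

  For fixed \<open>K\<close>, the marked groups that contain an evasive element for complexity \<open>K\<close> form an
  open set (\<open>openin_evasive_groups\<close>), since a witness only involves the words of the normal
  subgroup up to some length. Intersecting over \<open>K\<close> gives a \<open>G\<^sub>\<delta>\<close> set of topologizable groups, and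
  it remains to see that it contains all of \<open>\<S>\<close>, which is dense in its closure.

  So let \<open>G\<close> act acylindrically with unbounded orbits on a hyperbolic space. There are a base
  point and an element \<open>h\<close> whose powers move it along a quasi-geodesic (\<open>ex_axial\<close>); otherwise
  \<open>G\<close> would almost fix a boundary point, so that any finite set of elements would move two distant
  points of a ray a bounded amount, against acylindricity. Put \<open>g = h ^ (M m)\<close>. Acylindricity
  gives \<open>M\<close> such that a coefficient \<open>a\<close> of bounded size either satisfies
  \<open>h\<^sup>M a = a h\<^sup>M\<close> or \<open>h\<^sup>M a = a h\<^sup>-\<^sup>M\<close>, or makes the axes of \<open>h\<close> and of its conjugate by \<open>a\<close>
  diverge (\<open>parallel_or_divergent\<close>). Coefficients of the first kind can be moved past powers of
  the variable, changing the value of the word neither at \<open>g\<close> nor at \<open>1\<close>. If the variable does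
  not disappear in this way, then for large \<open>m\<close> the word describes a broken path with long sides
  and bounded backtracking, which is not closed (\<open>normal_word_nontrivial\<close>); if it disappears, then
  the values at \<open>g\<close> and \<open>1\<close> agree.
\<close>

section \<open>Group topologies from norms\<close>

lemma (in group) mult_inv_cancel:
  assumes "x \<in> carrier G" "y \<in> carrier G"
  shows "x \<otimes> (inv x \<otimes> y) = y" "inv x \<otimes> (x \<otimes> y) = y"
  using assms by (simp_all flip: m_assoc)

text \<open>
  A norm defines a left invariant metric. Its topology is a group topology as soon as every
  conjugation is Lipschitz for the norm, because \<open>(x y)\<^sup>-\<^sup>1 (x' y')\<close> is the product of a conjugate
  of \<open>x\<^sup>-\<^sup>1 x'\<close> by \<open>y\<^sup>-\<^sup>1\<close> and \<open>y\<^sup>-\<^sup>1 y'\<close>, and similarly for inverses.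
\<close>

lemma (in group) topologizable_of_norm:
  fixes \<nu> :: "'a \<Rightarrow> real"
  assumes one: "\<nu> \<one> = 0"
    and pos: "\<And>x. x \<in> carrier G \<Longrightarrow> x \<noteq> \<one> \<Longrightarrow> 0 < \<nu> x"
    and inv: "\<And>x. x \<in> carrier G \<Longrightarrow> \<nu> (inv x) = \<nu> x"
    and mult: "\<And>x y. x \<in> carrier G \<Longrightarrow> y \<in> carrier G \<Longrightarrow> \<nu> (x \<otimes> y) \<le> \<nu> x + \<nu> y"
    and conj: "\<And>b. b \<in> carrier G \<Longrightarrow>
        \<exists>L>0. \<forall>x\<in>carrier G. \<nu> (b \<otimes> x \<otimes> inv b) \<le> L * \<nu> x"
    and small: "\<And>\<epsilon>. 0 < \<epsilon> \<Longrightarrow> \<exists>x\<in>carrier G. x \<noteq> \<one> \<and> \<nu> x < \<epsilon>"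
  shows "topologizable G"
proof -
  define dist where
    "dist x y = (if x \<in> carrier G \<and> y \<in> carrier G then \<nu> (inv x \<otimes> y) else 0)" for x y
  have nonneg: "0 \<le> \<nu> x" if "x \<in> carrier G" for x
    using one pos[OF that] by (cases "x = \<one>") auto
  have sym: "\<nu> (inv x \<otimes> y) = \<nu> (inv y \<otimes> x)" if "x \<in> carrier G" "y \<in> carrier G" for x y
    using inv[of "inv x \<otimes> y"] that by (simp add: inv_mult_group)
  interpret M: Metric_space "carrier G" dist
  proof
    show "0 \<le> dist x y" for x y
      by (simp add: dist_def nonneg)
    show "dist x y = dist y x" for x y
      by (simp add: dist_def sym)
    show "dist x y = 0 \<longleftrightarrow> x = y" if "x \<in> carrier G" "y \<in> carrier G" for x y
    proof
      assume "dist x y = 0"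
      then have "inv x \<otimes> y = \<one>"
        using that pos[of "inv x \<otimes> y"] by (force simp: dist_def)
      then show "x = y"
        using that by (metis inv_equality inv_inv inv_closed)
    qed (use that one in \<open>simp add: dist_def\<close>)
    show "dist x z \<le> dist x y + dist y z"
      if "x \<in> carrier G" "y \<in> carrier G" "z \<in> carrier G" for x y z
    proof -
      have "inv x \<otimes> z = (inv x \<otimes> y) \<otimes> (inv y \<otimes> z)"
        using that by (simp add: m_assoc mult_inv_cancel)
      then show ?thesis
        using that mult[of "inv x \<otimes> y" "inv y \<otimes> z"] by (simp add: dist_def)
    qed
  qed
  have mult_cont: "continuous_map (prod_topology M.mtopology M.mtopology) M.mtopology
      (\<lambda>(x, y). x \<otimes> y)"
    unfolding M.continuous_map_to_metric
  proof (intro ballI allI impI)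
    fix p and \<epsilon> :: real
    assume "p \<in> topspace (prod_topology M.mtopology M.mtopology)" and \<epsilon>: "0 < \<epsilon>"
    then obtain x y where p: "p = (x, y)" and xy: "x \<in> carrier G" "y \<in> carrier G"
      by auto
    obtain L where L: "0 < L" "\<And>u. u \<in> carrier G \<Longrightarrow> \<nu> (inv y \<otimes> u \<otimes> y) \<le> L * \<nu> u"
      using conj[of "inv y"] xy by auto
    define U where "U = M.mball x (\<epsilon> / (2 * L)) \<times> M.mball y (\<epsilon> / 2)"
    have "openin (prod_topology M.mtopology M.mtopology) U"
      by (simp add: U_def openin_prod_Times_iff)
    moreover have "p \<in> U"
      using p xy \<epsilon> L(1) by (simp add: U_def)
    moreover have "(\<lambda>(x, y). x \<otimes> y) q \<in> M.mball ((\<lambda>(x, y). x \<otimes> y) p) \<epsilon>" if q: "q \<in> U" for q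
    proof -
      obtain x' y' where q': "q = (x', y')" "x' \<in> carrier G" "y' \<in> carrier G"
        and d: "dist x x' < \<epsilon> / (2 * L)" "dist y y' < \<epsilon> / 2"
        using q by (auto simp: U_def)
      have "inv (x \<otimes> y) \<otimes> (x' \<otimes> y') = (inv y \<otimes> (inv x \<otimes> x') \<otimes> y) \<otimes> (inv y \<otimes> y')"
        using xy q' by (simp add: inv_mult_group m_assoc mult_inv_cancel)
      then have "dist (x \<otimes> y) (x' \<otimes> y') \<le> \<nu> (inv y \<otimes> (inv x \<otimes> x') \<otimes> y) + \<nu> (inv y \<otimes> y')"
        using mult[of "inv y \<otimes> (inv x \<otimes> x') \<otimes> y" "inv y \<otimes> y'"] xy q' by (simp add: dist_def)
      also have "\<dots> \<le> L * dist x x' + dist y y'"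
        using L(2)[of "inv x \<otimes> x'"] xy q' by (simp add: dist_def)
      also have "\<dots> < \<epsilon>"
        using d L(1) by (simp add: field_simps)
      finally show ?thesis
        using p q' xy by simp
    qed
    ultimately show "\<exists>U. openin (prod_topology M.mtopology M.mtopology) U \<and> p \<in> U \<and>
        (\<forall>q\<in>U. (\<lambda>(x, y). x \<otimes> y) q \<in> M.mball ((\<lambda>(x, y). x \<otimes> y) p) \<epsilon>)"
      by blast
  qed
  have inv_cont: "continuous_map M.mtopology M.mtopology (\<lambda>x. inv x)"
    unfolding M.continuous_map_to_metric
  proof (intro ballI allI impI)
    fix x and \<epsilon> :: real
    assume "x \<in> topspace M.mtopology" and \<epsilon>: "0 < \<epsilon>"
    then have x: "x \<in> carrier G"
      by simp
    obtain L where L: "0 < L" "\<And>u. u \<in> carrier G \<Longrightarrow> \<nu> (x \<otimes> u \<otimes> inv x) \<le> L * \<nu> u"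
      using conj[OF x] by auto
    have "inv y \<in> M.mball (inv x) \<epsilon>" if "y \<in> M.mball x (\<epsilon> / L)" for y
    proof -
      have y: "y \<in> carrier G" "dist x y < \<epsilon> / L"
        using that by auto
      have "dist (inv x) (inv y) = \<nu> (x \<otimes> inv y)"
        using x y by (simp add: dist_def)
      also have "x \<otimes> inv y = x \<otimes> (inv y \<otimes> x) \<otimes> inv x"
        using x y by (simp add: m_assoc)
      also have "\<nu> \<dots> \<le> L * dist x y"
        using L(2)[of "inv y \<otimes> x"] x y sym[of x y] by (simp add: dist_def)
      also have "\<dots> < \<epsilon>"
        using y L(1) by (simp add: field_simps)
      finally show ?thesis
        using x y by simp
    qed
    moreover have "x \<in> M.mball x (\<epsilon> / L)"
      using x \<epsilon> L(1) by simp
    ultimately show "\<exists>U. openin M.mtopology U \<and> x \<in> U \<and>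
        (\<forall>y\<in>U. inv y \<in> M.mball (inv x) \<epsilon>)"
      using M.openin_mball by blast
  qed
  have "M.mtopology \<noteq> discrete_topology (carrier G)"
  proof
    assume "M.mtopology = discrete_topology (carrier G)"
    then have "openin M.mtopology {\<one>}"
      by simp
    then obtain r where r: "0 < r" "M.mball \<one> r \<subseteq> {\<one>}"
      unfolding M.openin_mtopology by auto
    obtain x where "x \<in> carrier G" "x \<noteq> \<one>" "\<nu> x < r"
      using small[OF r(1)] by blast
    then show False
      using r(2) by (auto simp: M.mball_def dist_def subset_iff)
  qed
  then show ?thesis
    unfolding topologizable_def group_topology_def
    using mult_cont inv_cont M.Hausdorff_space_mtopology M.topspace_mtopology by blast
qed

section \<open>Words with one variable and a criterion for topologizability\<close>

text \<open>
  The list \<open>[(a\<^sub>1, n\<^sub>1), \<dots>, (a\<^sub>r, n\<^sub>r)]\<close> stands for \<open>a\<^sub>1 X\<^bsup>n\<^sub>1\<^esup> \<dots> a\<^sub>r X\<^bsup>n\<^sub>r\<^esup>\<close>. Exponents may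
  vanish, so a word can end with a coefficient.
\<close>

primrec word_value ::
    "('a, 'b) monoid_scheme \<Rightarrow> 'a \<Rightarrow> ('a \<times> int) list \<Rightarrow> 'a" where
  "word_value G x [] = \<one>\<^bsub>G\<^esub>"
| "word_value G x (p # w) = fst p \<otimes>\<^bsub>G\<^esub> x [^]\<^bsub>G\<^esub> snd p \<otimes>\<^bsub>G\<^esub> word_value G x w"

definition word_cost :: "('a \<Rightarrow> nat) \<Rightarrow> ('a \<times> int) list \<Rightarrow> nat" where
  "word_cost len w = (\<Sum>p\<leftarrow>w. len (fst p) + nat \<bar>snd p\<bar>)"

text \<open>
  The subgroup \<open>H\<close> is a parameter so that the notion can be stated about the free group for
  all its quotients at once.
\<close>

definition evasive ::
    "('a, 'b) monoid_scheme \<Rightarrow> 'a set \<Rightarrow> ('a \<Rightarrow> nat) \<Rightarrow> nat \<Rightarrow> 'a \<Rightarrow> bool" where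
  "evasive G H len K g \<longleftrightarrow> (\<forall>w. set w \<subseteq> carrier G \<times> UNIV \<longrightarrow> word_cost len w \<le> K \<longrightarrow>
     word_value G g w \<in> H \<longrightarrow> word_value G \<one>\<^bsub>G\<^esub> w \<in> H)"

lemma word_cost_simps [simp]:
  "word_cost len [] = 0"
  "word_cost len (p # w) = len (fst p) + nat \<bar>snd p\<bar> + word_cost len w"
  by (simp_all add: word_cost_def)

context group
begin

lemma word_value_closed [simp]:
  "x \<in> carrier G \<Longrightarrow> set w \<subseteq> carrier G \<times> UNIV \<Longrightarrow> word_value G x w \<in> carrier G"
  by (induction w) auto

end

text \<open>
  A factor \<open>(a, n, e)\<close> stands for the conjugate by \<open>a\<close> of the \<open>e\<close>-th power of the \<open>n\<close>-th
  element of the sequence. Its cost below makes conjugation by \<open>b\<close> stretch costs by at most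
  \<open>2 ^ len b\<close>, while the elements of the sequence themselves have cost tending to zero.
\<close>

primrec conj_product ::
    "('a, 'b) monoid_scheme \<Rightarrow> (nat \<Rightarrow> 'a) \<Rightarrow> ('a \<times> nat \<times> int) list \<Rightarrow> 'a" where
  "conj_product G \<gamma> [] = \<one>\<^bsub>G\<^esub>"
| "conj_product G \<gamma> (f # F) = (case f of (a, n, e) \<Rightarrow>
     a \<otimes>\<^bsub>G\<^esub> \<gamma> n [^]\<^bsub>G\<^esub> e \<otimes>\<^bsub>G\<^esub> inv\<^bsub>G\<^esub> a) \<otimes>\<^bsub>G\<^esub> conj_product G \<gamma> F"

definition conj_cost :: "('a \<Rightarrow> nat) \<Rightarrow> ('a \<times> nat \<times> int) list \<Rightarrow> real" where
  "conj_cost len F = (\<Sum>(a, n, e)\<leftarrow>F. 2 ^ len a / 2 ^ n)"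

lemma conj_cost_simps [simp]:
  "conj_cost len [] = 0"
  "conj_cost len ((a, n, e) # F) = 2 ^ len a / 2 ^ n + conj_cost len F"
  "conj_cost len (E @ F) = conj_cost len E + conj_cost len F"
  by (simp_all add: conj_cost_def)

lemma conj_cost_nonneg: "0 \<le> conj_cost len F"
  by (induction F) auto

lemma conj_cost_ge_factor: "(a, n, e) \<in> set F \<Longrightarrow> 2 ^ len a / 2 ^ n \<le> conj_cost len F"
proof (induction F)
  case (Cons f F)
  then show ?case
    using conj_cost_nonneg[of len F] by (cases f) (auto intro: add_increasing)
qed simp

lemma conj_cost_ge_length:
  assumes "\<And>a m e. (a, m, e) \<in> set F \<Longrightarrow> m \<le> n"
  shows "real (length F) / 2 ^ n \<le> conj_cost len F"
  using assms
proof (induction F)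
  case (Cons f F)
  obtain a m e where f: "f = (a, m, e)"
    by (cases f)
  have "m \<le> n"
    using Cons.prems f by auto
  then have "(1::real) * 2 ^ m \<le> 2 ^ len a * 2 ^ n"
    by (intro mult_mono power_increasing) auto
  then have "(1::real) / 2 ^ n \<le> 2 ^ len a / 2 ^ m"
    by (simp add: field_simps)
  moreover have "real (length F) / 2 ^ n \<le> conj_cost len F"
    by (rule Cons.IH) (use Cons.prems in auto)
  ultimately show ?case
    by (simp add: f add_divide_distrib)
qed simp

lemma conj_cost_filter_le: "conj_cost len (filter P F) \<le> conj_cost len F"
proof (induction F)
  case (Cons f F)
  then show ?case
    by (cases f) (auto intro: add_increasing)
qed simp

abbreviation valid_factors :: "('a, 'b) monoid_scheme \<Rightarrow> ('a \<times> nat \<times> int) list \<Rightarrow> bool" where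
  "valid_factors G F \<equiv> set F \<subseteq> carrier G \<times> UNIV \<times> {1, -1}"

context group
begin

lemma conj_product_closed [simp]:
  "range \<gamma> \<subseteq> carrier G \<Longrightarrow> valid_factors G F \<Longrightarrow> conj_product G \<gamma> F \<in> carrier G"
  by (induction F) (auto simp: image_subset_iff)

lemma conj_product_append:
  assumes "range \<gamma> \<subseteq> carrier G" "valid_factors G E" "valid_factors G F"
  shows "conj_product G \<gamma> (E @ F) = conj_product G \<gamma> E \<otimes> conj_product G \<gamma> F"
  using assms(2)
proof (induction E)
  case (Cons f E)
  then show ?case
    using assms(1,3) by (cases f) (auto simp: image_subset_iff m_assoc)
qed (use assms in auto)

lemma conj_product_inverse:
  assumes \<gamma>: "range \<gamma> \<subseteq> carrier G" and "valid_factors G F"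
  shows "\<exists>E. valid_factors G E \<and> conj_cost len E = conj_cost len F \<and>
    conj_product G \<gamma> E = inv (conj_product G \<gamma> F)"
  using assms(2)
proof (induction F)
  case (Cons f F)
  obtain a n e where f: "f = (a, n, e)"
    by (cases f)
  have v: "a \<in> carrier G" "e = 1 \<or> e = -1" "valid_factors G F" "\<gamma> n \<in> carrier G"
    using Cons.prems f \<gamma> by auto
  obtain E where E: "valid_factors G E" "conj_cost len E = conj_cost len F"
      "conj_product G \<gamma> E = inv (conj_product G \<gamma> F)"
    using Cons.IH v by auto
  have "conj_product G \<gamma> (E @ [(a, n, -e)]) = inv (conj_product G \<gamma> (f # F))"
    using conj_product_append[OF \<gamma> E(1), of "[(a, n, -e)]"] v f \<gamma> E(3)
    by (auto simp: inv_mult_group m_assoc int_pow_neg)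
  then show ?case
    using E v f by (intro exI[of _ "E @ [(a, n, -e)]"]) auto
qed (auto intro: exI[of _ "[]"])

lemma conj_product_conjugate:
  assumes \<gamma>: "range \<gamma> \<subseteq> carrier G" and "valid_factors G F" and b: "b \<in> carrier G"
    and len: "\<And>x y. x \<in> carrier G \<Longrightarrow> y \<in> carrier G \<Longrightarrow> len (x \<otimes> y) \<le> len x + len y"
  shows "\<exists>E. valid_factors G E \<and> conj_cost len E \<le> 2 ^ len b * conj_cost len F \<and>
    conj_product G \<gamma> E = b \<otimes> conj_product G \<gamma> F \<otimes> inv b"
  using assms(2)
proof (induction F)
  case (Cons f F)
  obtain a n e where f: "f = (a, n, e)"
    by (cases f)
  have v: "a \<in> carrier G" "e = 1 \<or> e = -1" "valid_factors G F" "\<gamma> n \<in> carrier G"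
    using Cons.prems f \<gamma> by auto
  obtain E where E: "valid_factors G E" "conj_cost len E \<le> 2 ^ len b * conj_cost len F"
      "conj_product G \<gamma> E = b \<otimes> conj_product G \<gamma> F \<otimes> inv b"
    using Cons.IH v by auto
  have "(2::real) ^ len (b \<otimes> a) \<le> 2 ^ (len b + len a)"
    using len[OF b v(1)] by (intro power_increasing) auto
  then have "conj_cost len ((b \<otimes> a, n, e) # E) \<le> 2 ^ len b * conj_cost len (f # F)"
    using E(2) by (auto simp: f distrib_left power_add intro!: add_mono divide_right_mono)
  moreover have "conj_product G \<gamma> ((b \<otimes> a, n, e) # E) = b \<otimes> conj_product G \<gamma> (f # F) \<otimes> inv b"
    using E v f b \<gamma> by (simp add: inv_mult_group m_assoc mult_inv_cancel)
  moreover have "valid_factors G ((b \<otimes> a, n, e) # E)"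
    using E v b by auto
  ultimately show ?case
    by blast
qed (use b in \<open>auto intro: exI[of _ "[]"]\<close>)

text \<open>
  Replacing the entry of largest index \<open>n\<close> by the variable turns a product of conjugates into a
  word whose complexity is bounded in terms of the earlier entries only. Setting the variable to
  \<open>1\<close> collapses each conjugate of that entry, that is, removes these factors.
\<close>

lemma conj_product_as_word:
  assumes \<gamma>: "range \<gamma> \<subseteq> carrier G" and "valid_factors G F"
    and len_mult: "\<And>x y. x \<in> carrier G \<Longrightarrow> y \<in> carrier G \<Longrightarrow> len (x \<otimes> y) \<le> len x + len y"
    and len_inv: "\<And>x. x \<in> carrier G \<Longrightarrow> len (inv x) \<le> len x"
    and L: "\<And>m. m < n \<Longrightarrow> len (\<gamma> m) \<le> L"
    and F: "\<And>a m e. (a, m, e) \<in> set F \<Longrightarrow> m \<le> n \<and> len a \<le> n"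
  shows "\<exists>w. set w \<subseteq> carrier G \<times> UNIV \<and> word_cost len w \<le> length F * (2 * n + 1 + L) \<and>
    word_value G (\<gamma> n) w = conj_product G \<gamma> F \<and>
    word_value G \<one> w = conj_product G \<gamma> (filter (\<lambda>(a, m, e). m < n) F)"
  using assms(2) F
proof (induction F)
  case (Cons f F)
  obtain a m e where f: "f = (a, m, e)"
    by (cases f)
  have v: "a \<in> carrier G" "e = 1 \<or> e = -1" "valid_factors G F" "\<And>i. \<gamma> i \<in> carrier G"
    using Cons.prems f \<gamma> by auto
  have le: "m \<le> n" "len a \<le> n"
    using Cons.prems f by auto
  obtain w where w: "set w \<subseteq> carrier G \<times> UNIV" "word_cost len w \<le> length F * (2 * n + 1 + L)"
      "word_value G (\<gamma> n) w = conj_product G \<gamma> F"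
      "word_value G \<one> w = conj_product G \<gamma> (filter (\<lambda>(a, m, e). m < n) F)"
    using Cons.IH[OF v(3)] Cons.prems(2) by (metis list.set_intros(2))
  have inv_le: "len (inv a) \<le> n"
    using len_inv[OF v(1)] le by simp
  show ?case
  proof (cases "m < n")
    case True
    define c where "c = a \<otimes> \<gamma> m [^] e \<otimes> inv a"
    have c: "c \<in> carrier G"
      using v by (simp add: c_def)
    have "len (\<gamma> m [^] e) \<le> L"
      using v(2) v(4)[of m] L[OF True] len_inv[OF v(4)[of m]] by (auto simp: int_pow_neg)
    then have "len c \<le> 2 * n + L"
      using len_mult[of "a \<otimes> \<gamma> m [^] e" "inv a"] len_mult[of a "\<gamma> m [^] e"] v le inv_le
      by (simp add: c_def)
    then have "word_cost len ((c, 0) # w) \<le> length (f # F) * (2 * n + 1 + L)"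
      using w(2) by simp
    moreover have "word_value G (\<gamma> n) ((c, 0) # w) = conj_product G \<gamma> (f # F)"
      using w c by (simp add: f c_def[symmetric])
    moreover have "word_value G \<one> ((c, 0) # w) =
        conj_product G \<gamma> (filter (\<lambda>(a, m, e). m < n) (f # F))"
      using w c True by (simp add: f c_def[symmetric])
    moreover have "set ((c, 0) # w) \<subseteq> carrier G \<times> UNIV"
      using w c by simp
    ultimately show ?thesis
      by blast
  next
    case False
    then have m: "m = n"
      using le by simp
    have "nat \<bar>e\<bar> = 1"
      using v(2) by auto
    then have "word_cost len ((a, e) # (inv a, 0) # w) \<le> length (f # F) * (2 * n + 1 + L)"
      using w(2) le inv_le by simp
    moreover have "word_value G (\<gamma> n) ((a, e) # (inv a, 0) # w) = conj_product G \<gamma> (f # F)"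
      using w v \<gamma> by (simp add: f m m_assoc)
    moreover have "word_value G \<one> ((a, e) # (inv a, 0) # w) =
        conj_product G \<gamma> (filter (\<lambda>(a, m, e). m < n) (f # F))"
    proof -
      have "word_value G \<one> w \<in> carrier G"
        using w(1) by simp
      then show ?thesis
        using w(4) v m by (simp add: f mult_inv_cancel)
    qed
    moreover have "set ((a, e) # (inv a, 0) # w) \<subseteq> carrier G \<times> UNIV"
      using w v by simp
    ultimately show ?thesis
      by blast
  qed
qed (auto intro: exI[of _ "[]"])

text \<open>
  If the total cost is below \<open>1 / 2 ^ len x\<close>, then every index that occurs exceeds \<open>len x\<close>, and
  for the largest index \<open>n\<close> there are fewer than \<open>2 ^ n\<close> factors, with conjugators shorter than
  \<open>n\<close>. So \<open>x\<^sup>-\<^sup>1\<close> times the product is a word in \<open>\<gamma> n\<close> of the complexity for which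
  \<open>\<gamma> n\<close> is evasive, and the factors of index \<open>n\<close> can be dropped without changing the product.
\<close>

lemma cheap_conj_product_trivial:
  assumes \<gamma>: "range \<gamma> \<subseteq> carrier G"
    and len_mult: "\<And>x y. x \<in> carrier G \<Longrightarrow> y \<in> carrier G \<Longrightarrow> len (x \<otimes> y) \<le> len x + len y"
    and len_inv: "\<And>x. x \<in> carrier G \<Longrightarrow> len (inv x) \<le> len x"
    and L: "\<And>m n. m < n \<Longrightarrow> len (\<gamma> m) \<le> L n"
    and evasive: "\<And>n. evasive G {\<one>} len (n + 2 ^ n * (2 * n + 1 + L n)) (\<gamma> n)"
    and F: "valid_factors G F" "conj_product G \<gamma> F = x" "conj_cost len F < 1 / 2 ^ len x"
  shows "x = \<one>"
proof -
  have "\<And>F. valid_factors G F \<Longrightarrow> (\<And>a m e. (a, m, e) \<in> set F \<Longrightarrow> m < N) \<Longrightarrow>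
      conj_product G \<gamma> F = x \<Longrightarrow> conj_cost len F < 1 / 2 ^ len x \<Longrightarrow> x = \<one>" for N
  proof (induction N)
    case 0
    then have "F = []"
      by (cases F) auto
    then show ?case
      using 0 by simp
  next
    case (Suc n)
    have x: "x \<in> carrier G"
      using Suc.prems \<gamma> by auto
    have small: "len a < m" "len x < m" if f: "(a, m, e) \<in> set F" for a m e
    proof -
      have "(2::real) ^ len a / 2 ^ m < 1 / 2 ^ len x"
        using conj_cost_ge_factor[OF f, of len] Suc.prems(4) by linarith
      then have "(2::real) ^ (len a + len x) < 2 ^ m"
        by (simp add: field_simps power_add)
      then have "len a + len x < m"
        by (simp add: power_strict_increasing_iff)
      then show "len a < m" "len x < m"
        by auto
    qed
    show ?case
    proof (cases "F = []")
      case True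
      then show ?thesis
        using Suc.prems by simp
    next
      case False
      then obtain a m e where "(a, m, e) \<in> set F"
        by (cases F) auto
      then have len_x: "len x \<le> n"
        using small(2) Suc.prems(2) by fastforce
      have bounds: "m \<le> n \<and> len a \<le> n" if "(a, m, e) \<in> set F" for a m e
        using small(1)[OF that] Suc.prems(2)[OF that] by simp
      have "real (length F) / 2 ^ n < 1"
      proof -
        have "real (length F) / 2 ^ n \<le> conj_cost len F"
          by (rule conj_cost_ge_length) (use bounds in blast)
        also have "\<dots> < 1 / 2 ^ len x"
          by (rule Suc.prems)
        also have "\<dots> \<le> 1"
          by simp
        finally show ?thesis .
      qed
      then have "real (length F) < real (2 ^ n)"
        by (simp add: field_simps)
      then have "length F < 2 ^ n"
        by (simp only: of_nat_less_iff)
      then have length: "length F * (2 * n + 1 + L n) \<le> 2 ^ n * (2 * n + 1 + L n)"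
        by (intro mult_right_mono) auto
      define E where "E = filter (\<lambda>(a, m, e). m < n) F"
      have "\<exists>w. set w \<subseteq> carrier G \<times> UNIV \<and> word_cost len w \<le> length F * (2 * n + 1 + L n) \<and>
          word_value G (\<gamma> n) w = conj_product G \<gamma> F \<and> word_value G \<one> w = conj_product G \<gamma> E"
        unfolding E_def
      proof (rule conj_product_as_word[OF \<gamma> Suc.prems(1)])
        show "m \<le> n \<and> len a \<le> n" if "(a, m, e) \<in> set F" for a m e
          by (rule bounds[OF that])
      qed (simp_all add: len_mult len_inv L)
      then obtain w where w: "set w \<subseteq> carrier G \<times> UNIV"
          "word_cost len w \<le> length F * (2 * n + 1 + L n)"
          "word_value G (\<gamma> n) w = x" "word_value G \<one> w = conj_product G \<gamma> E"
        using Suc.prems(3) by blast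
      let ?w = "(inv x, 0) # w"
      have "set ?w \<subseteq> carrier G \<times> UNIV"
        using w x by simp
      moreover have "word_cost len ?w \<le> n + 2 ^ n * (2 * n + 1 + L n)"
        using w(2) length len_x len_inv[OF x] by simp
      moreover have "word_value G (\<gamma> n) ?w = \<one>"
        using w x by simp
      ultimately have "word_value G \<one> ?w = \<one>"
        using evasive[of n] unfolding evasive_def by blast
      moreover have E: "valid_factors G E"
        using Suc.prems(1) by (auto simp: E_def)
      ultimately have "inv x \<otimes> conj_product G \<gamma> E = \<one>"
        using w x conj_product_closed[OF \<gamma>] by simp
      then have "conj_product G \<gamma> E = x"
        using inv_equality[of "inv x"] x conj_product_closed[OF \<gamma> E] by (metis inv_closed inv_inv)
      moreover have "conj_cost len E < 1 / 2 ^ len x"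
        using conj_cost_filter_le Suc.prems(4) unfolding E_def by (rule le_less_trans)
      moreover have "m < n" if "(a, m, e) \<in> set E" for a m e
        using that by (simp add: E_def)
      ultimately show ?thesis
        using Suc.IH[OF E] by blast
    qed
  qed
  moreover have "\<exists>N. \<forall>(a, m, e)\<in>set F. m < N"
  proof (intro exI ballI)
    fix f assume "f \<in> set F"
    then have "fst (snd f) \<le> Max ((fst \<circ> snd) ` set F)"
      by auto
    then show "case f of (a, m, e) \<Rightarrow> m < Suc (Max ((fst \<circ> snd) ` set F))"
      by (simp add: case_prod_unfold)
  qed
  ultimately show ?thesis
    using F by blast
qed

text \<open>
  The required complexity of \<open>\<gamma> n\<close> depends on the lengths of the earlier entries of the sequence.
  Since only a bound \<open>L n\<close> on these lengths matters, it suffices to define \<open>L\<close> by recursion.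
\<close>

theorem topologizable_if_evasive:
  fixes len :: "'a \<Rightarrow> nat"
  assumes len_mult: "\<And>x y. x \<in> carrier G \<Longrightarrow> y \<in> carrier G \<Longrightarrow> len (x \<otimes> y) \<le> len x + len y"
    and len_inv: "\<And>x. x \<in> carrier G \<Longrightarrow> len (inv x) \<le> len x"
    and len_one: "len \<one> = 0"
    and ex: "\<And>K. \<exists>g\<in>carrier G. g \<noteq> \<one> \<and> evasive G {\<one>} len K g"
  shows "topologizable G"
proof -
  define pick where "pick K = (SOME g. g \<in> carrier G \<and> g \<noteq> \<one> \<and> evasive G {\<one>} len K g)" for K
  have pick: "pick K \<in> carrier G \<and> pick K \<noteq> \<one> \<and> evasive G {\<one>} len K (pick K)" for K
    unfolding pick_def by (rule someI_ex) (use ex[of K] in blast)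
  define \<kappa> where "\<kappa> n L = n + 2 ^ n * (2 * n + 1 + L)" for n L :: nat
  define L where "L = rec_nat 0 (\<lambda>n l. max l (len (pick (\<kappa> n l))))"
  define \<gamma> where "\<gamma> n = pick (\<kappa> n (L n))" for n
  have L_Suc: "L (Suc n) = max (L n) (len (\<gamma> n))" for n
    by (simp add: L_def \<gamma>_def)
  have L: "len (\<gamma> m) \<le> L n" if "m < n" for m n
    using that by (induction n) (auto simp: L_Suc less_Suc_eq)
  have \<gamma>: "range \<gamma> \<subseteq> carrier G"
    using pick by (auto simp: \<gamma>_def)
  have ev: "evasive G {\<one>} len (n + 2 ^ n * (2 * n + 1 + L n)) (\<gamma> n)" for n
    using pick[of "\<kappa> n (L n)"] by (simp add: \<gamma>_def \<kappa>_def)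
  define C where "C x = insert 1 (conj_cost len `
    {F. valid_factors G F \<and> conj_product G \<gamma> F = x})" for x
  define \<nu> where "\<nu> x = Inf (C x)" for x
  have C_nonneg: "0 \<le> c" if "c \<in> C x" for c x
    using that conj_cost_nonneg by (auto simp: C_def)
  have C_ne: "C x \<noteq> {}" for x
    by (simp add: C_def)
  have bdd: "bdd_below (C x)" for x
    by (rule bdd_belowI[of _ 0]) (rule C_nonneg)
  have \<nu>_le: "\<nu> x \<le> c" if "c \<in> C x" for c x
    unfolding \<nu>_def by (rule cInf_lower[OF that bdd])
  have \<nu>_ge: "b \<le> \<nu> x" if "\<And>c. c \<in> C x \<Longrightarrow> b \<le> c" for b x
    unfolding \<nu>_def by (rule cInf_greatest[OF C_ne that])
  have \<nu>_le_cost: "\<nu> (conj_product G \<gamma> F) \<le> conj_cost len F" if "valid_factors G F" for F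
    by (rule \<nu>_le) (use that in \<open>auto simp: C_def\<close>)
  have \<nu>_le_1: "\<nu> x \<le> 1" for x
    by (rule \<nu>_le) (simp add: C_def)
  show ?thesis
  proof (rule topologizable_of_norm)
    show "\<nu> \<one> = 0"
    proof (rule antisym)
      show "\<nu> \<one> \<le> 0"
        using \<nu>_le_cost[of "[]"] by simp
      show "0 \<le> \<nu> \<one>"
        by (rule \<nu>_ge) (rule C_nonneg)
    qed
    show "0 < \<nu> x" if "x \<in> carrier G" and xne: "x \<noteq> \<one>" for x
    proof -
      have "1 / 2 ^ len x \<le> \<nu> x"
      proof (rule \<nu>_ge)
        fix c assume c: "c \<in> C x"
        show "1 / 2 ^ len x \<le> c"
        proof (cases "c = 1")
          case False
          then obtain F where F: "valid_factors G F" "conj_product G \<gamma> F = x"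
              "c = conj_cost len F"
            using c by (auto simp: C_def)
          have "x = \<one>" if "conj_cost len F < 1 / 2 ^ len x"
            by (rule cheap_conj_product_trivial[OF \<gamma> _ _ _ ev F(1,2) that])
              (simp_all add: len_mult len_inv L)
          then show ?thesis
            using F xne by (metis not_le)
        qed simp
      qed
      then show ?thesis
        by (rule less_le_trans[rotated]) simp
    qed
    have inv_le: "\<nu> (inv x) \<le> \<nu> x" for x
    proof (rule \<nu>_ge)
      fix c assume c: "c \<in> C x"
      show "\<nu> (inv x) \<le> c"
      proof (cases "c = 1")
        case False
        then obtain F where F: "valid_factors G F" "conj_product G \<gamma> F = x" "c = conj_cost len F"
          using c by (auto simp: C_def)
        then show ?thesis
          using conj_product_inverse[OF \<gamma> F(1), of len] \<nu>_le_cost by metis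
      qed (use \<nu>_le_1 in simp)
    qed
    show "\<nu> (inv x) = \<nu> x" if "x \<in> carrier G" for x
      using inv_le[of x] inv_le[of "inv x"] that by (intro antisym) simp_all
    show "\<nu> (x \<otimes> y) \<le> \<nu> x + \<nu> y" if "x \<in> carrier G" "y \<in> carrier G" for x y
    proof -
      have sum: "\<nu> (x \<otimes> y) \<le> c + c'" if c: "c \<in> C x" and c': "c' \<in> C y" for c c'
      proof (cases "c = 1 \<or> c' = 1")
        case True
        then show ?thesis
          using \<nu>_le_1[of "x \<otimes> y"] C_nonneg[OF c] C_nonneg[OF c'] by auto
      next
        case False
        then obtain E F where "valid_factors G E" "conj_product G \<gamma> E = x" "c = conj_cost len E"
            and "valid_factors G F" "conj_product G \<gamma> F = y" "c' = conj_cost len F"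
          using c c' by (auto simp: C_def)
        then show ?thesis
          using \<nu>_le_cost[of "E @ F"] by (simp add: conj_product_append[OF \<gamma>])
      qed
      have "\<nu> (x \<otimes> y) - c \<le> \<nu> y" if "c \<in> C x" for c
        by (rule \<nu>_ge) (use sum[OF that] in \<open>simp add: algebra_simps\<close>)
      then have "\<nu> (x \<otimes> y) - \<nu> y \<le> \<nu> x"
        by (intro \<nu>_ge) (simp add: algebra_simps)
      then show ?thesis
        by simp
    qed
    show "\<exists>L>0. \<forall>x\<in>carrier G. \<nu> (b \<otimes> x \<otimes> inv b) \<le> L * \<nu> x" if b: "b \<in> carrier G" for b
    proof (intro exI conjI ballI)
      fix x assume "x \<in> carrier G"
      have "\<nu> (b \<otimes> x \<otimes> inv b) / 2 ^ len b \<le> \<nu> x"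
      proof (rule \<nu>_ge)
        fix c assume c: "c \<in> C x"
        show "\<nu> (b \<otimes> x \<otimes> inv b) / 2 ^ len b \<le> c"
        proof (cases "c = 1")
          case True
          have "\<nu> (b \<otimes> x \<otimes> inv b) \<le> 2 ^ len b"
            using \<nu>_le_1 one_le_power[of "2::real" "len b"] by (smt (verit))
          then show ?thesis
            using True by (simp add: field_simps)
        next
          case False
          then obtain F where F: "valid_factors G F" "conj_product G \<gamma> F = x"
              "c = conj_cost len F"
            using c by (auto simp: C_def)
          obtain E where E: "valid_factors G E" "conj_cost len E \<le> 2 ^ len b * conj_cost len F"
              "conj_product G \<gamma> E = b \<otimes> conj_product G \<gamma> F \<otimes> inv b"
            using conj_product_conjugate[of \<gamma> F b len] \<gamma> F(1) b len_mult by blast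
          have "\<nu> (b \<otimes> x \<otimes> inv b) \<le> 2 ^ len b * c"
            using \<nu>_le_cost[OF E(1)] E(2,3) F(2,3) by simp
          then show ?thesis
            by (simp add: field_simps)
        qed
      qed
      then show "\<nu> (b \<otimes> x \<otimes> inv b) \<le> 2 ^ len b * \<nu> x"
        by (simp add: field_simps)
    qed simp
    show "\<exists>x\<in>carrier G. x \<noteq> \<one> \<and> \<nu> x < \<epsilon>" if "0 < \<epsilon>" for \<epsilon>
    proof -
      obtain n where n: "(1 / 2) ^ n < \<epsilon>"
        using real_arch_pow_inv[OF \<open>0 < \<epsilon>\<close>, of "1 / 2"] by auto
      have "\<nu> (\<gamma> n) \<le> (1 / 2) ^ n"
        using \<nu>_le_cost[of "[(\<one>, n, 1)]"] \<gamma> len_one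
        by (auto simp: image_subset_iff power_divide)
      then show ?thesis
        using n pick by (intro bexI[of _ "\<gamma> n"]) (auto simp: \<gamma>_def)
    qed
  qed
qed

end

section \<open>Groups with a hyperbolic length function\<close>

text \<open>
  For the length function \<open>g \<mapsto> d(o, g o)\<close> of an isometric action, this is the Gromov product of
  \<open>g o\<close> and \<open>h o\<close> seen from the base point \<open>o\<close>.
\<close>

definition length_product :: "('a, 'b) monoid_scheme \<Rightarrow> ('a \<Rightarrow> real) \<Rightarrow> 'a \<Rightarrow> 'a \<Rightarrow> real" where
  "length_product G \<rho> g h = (\<rho> g + \<rho> h - \<rho> (inv\<^bsub>G\<^esub> g \<otimes>\<^bsub>G\<^esub> h)) / 2"

locale hyperbolic_length = group G for G (structure) +
  fixes \<rho> :: "'a \<Rightarrow> real" and \<delta> :: real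
  assumes length_one: "\<rho> \<one> = 0"
    and length_inv: "g \<in> carrier G \<Longrightarrow> \<rho> (inv g) = \<rho> g"
    and length_mult: "g \<in> carrier G \<Longrightarrow> h \<in> carrier G \<Longrightarrow> \<rho> (g \<otimes> h) \<le> \<rho> g + \<rho> h"
    and delta_nonneg: "0 \<le> \<delta>"
    and hyperbolicity: "f \<in> carrier G \<Longrightarrow> g \<in> carrier G \<Longrightarrow> h \<in> carrier G \<Longrightarrow>
      min (length_product G \<rho> f g) (length_product G \<rho> g h) - \<delta> \<le> length_product G \<rho> f h"
begin

abbreviation gp :: "'a \<Rightarrow> 'a \<Rightarrow> real" where
  "gp \<equiv> length_product G \<rho>"

lemma length_nonneg: "g \<in> carrier G \<Longrightarrow> 0 \<le> \<rho> g"
  using length_mult[of g "inv g"] by (simp add: length_inv length_one)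

lemma gp_commute: "g \<in> carrier G \<Longrightarrow> h \<in> carrier G \<Longrightarrow> gp g h = gp h g"
  using length_inv[of "inv g \<otimes> h"] by (simp add: length_product_def inv_mult_group)

lemma gp_le: "g \<in> carrier G \<Longrightarrow> h \<in> carrier G \<Longrightarrow> gp g h \<le> \<rho> g"
  using length_mult[of g "inv g \<otimes> h"] by (simp add: length_product_def mult_inv_cancel)

lemma gp_nonneg: "g \<in> carrier G \<Longrightarrow> h \<in> carrier G \<Longrightarrow> 0 \<le> gp g h"
  using length_mult[of "inv g" h] by (simp add: length_product_def length_inv)

lemma gp_self: "g \<in> carrier G \<Longrightarrow> gp g g = \<rho> g"
  by (simp add: length_product_def length_one)

text \<open>
  Seen from \<open>1\<close>, the product of \<open>u p\<close> and \<open>u\<close> tells how far the path from \<open>1\<close> to \<open>u p\<close> follows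
  the one to \<open>u\<close>; seen from \<open>u\<close>, the rest of the way to \<open>u\<close> is what the path backtracks.
\<close>

lemma gp_mult_left:
  assumes "u \<in> carrier G" "p \<in> carrier G"
  shows "gp (u \<otimes> p) u = \<rho> u - gp (inv u) p"
  using assms length_inv[of p]
  by (simp add: length_product_def inv_mult_group m_assoc length_inv field_simps)

lemma length_mult_gp:
  assumes "u \<in> carrier G" "p \<in> carrier G"
  shows "\<rho> (u \<otimes> p) = \<rho> u + \<rho> p - 2 * gp (inv u) p"
  using assms by (simp add: length_product_def length_inv field_simps)

lemma gp_perturb_right_factor:
  assumes "g \<in> carrier G" "a \<in> carrier G" "h \<in> carrier G"
  shows "gp (g \<otimes> a) h \<le> gp g h + \<rho> a"
proof -
  have "inv g \<otimes> h = a \<otimes> (inv (g \<otimes> a) \<otimes> h)"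
    using assms by (simp add: inv_mult_group m_assoc mult_inv_cancel)
  then show ?thesis
    using length_mult[of g a] length_mult[of a "inv (g \<otimes> a) \<otimes> h"] assms
    by (simp add: length_product_def field_simps)
qed

lemma gp_translate:
  assumes "g \<in> carrier G" "a \<in> carrier G" "h \<in> carrier G"
  shows "gp g h - \<rho> a \<le> gp (a \<otimes> g) (a \<otimes> h)"
proof -
  have "\<rho> x - \<rho> a \<le> \<rho> (a \<otimes> x)" if "x \<in> carrier G" for x
    using length_mult[of "inv a" "a \<otimes> x"] assms that by (simp add: length_inv mult_inv_cancel)
  then have "\<rho> g - \<rho> a \<le> \<rho> (a \<otimes> g)" "\<rho> h - \<rho> a \<le> \<rho> (a \<otimes> h)"
    using assms by auto
  moreover have "inv (a \<otimes> g) \<otimes> (a \<otimes> h) = inv g \<otimes> h"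
    using assms by (simp add: inv_mult_group m_assoc mult_inv_cancel)
  ultimately show ?thesis
    by (simp add: length_product_def field_simps)
qed

lemma foldr_mult_closed:
  "set us \<subseteq> carrier G \<Longrightarrow> foldr (\<otimes>) us \<one> \<in> carrier G"
  by (induction us) auto

text \<open>
  A broken path whose sides are long compared with the backtracking at its corners starts in the
  direction of its first side. By induction the path after the first corner starts in the
  direction of the second side, so hyperbolicity carries the bound on the backtracking between
  the first two sides over to the first side and the whole remaining path.
\<close>

lemma local_to_global:
  assumes "us \<noteq> []" "set us \<subseteq> carrier G" "0 \<le> \<beta>"
    and "\<And>u. u \<in> set us \<Longrightarrow> 2 * \<beta> + 2 * \<delta> < \<rho> u"
    and "successively (\<lambda>u v. gp (inv u) v \<le> \<beta>) us"
  shows "\<rho> (hd us) - \<beta> - \<delta> \<le> gp (foldr (\<otimes>) us \<one>) (hd us)"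
  using assms
proof (induction us)
  case (Cons u us)
  have u: "u \<in> carrier G"
    using Cons.prems by simp
  define p where "p = foldr (\<otimes>) us \<one>"
  have p: "p \<in> carrier G"
    using Cons.prems by (simp add: p_def foldr_mult_closed)
  show ?case
  proof (cases us)
    case Nil
    then show ?thesis
      using u Cons.prems delta_nonneg by (simp add: gp_self)
  next
    case (Cons v vs)
    have v: "v \<in> carrier G" "2 * \<beta> + 2 * \<delta> < \<rho> v" "gp (inv u) v \<le> \<beta>"
      using Cons.prems Cons by auto
    have "\<rho> v - \<beta> - \<delta> \<le> gp p v"
      using Cons.IH Cons.prems Cons by (simp add: p_def)
    then have "\<beta> + \<delta> < gp p v"
      using v by linarith
    moreover have "min (gp (inv u) p) (gp p v) - \<delta> \<le> gp (inv u) v"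
      using u p v by (simp add: hyperbolicity)
    ultimately have "gp (inv u) p \<le> \<beta> + \<delta>"
      using v by linarith
    then show ?thesis
      using gp_mult_left[OF u p] by (simp add: p_def)
  qed
qed simp

text \<open>
  The orbit of an axial element is a quasi-geodesic line, so axial elements act loxodromically.
\<close>

definition axial :: "'a \<Rightarrow> bool" where
  "axial h \<longleftrightarrow> h \<in> carrier G \<and> 2 * gp (inv h) h + 4 * \<delta> + 1 \<le> \<rho> h"

lemma axial_inv: "axial h \<Longrightarrow> axial (inv h)"
  using gp_commute[of h "inv h"] by (auto simp: axial_def length_inv)

lemma pow_comm_self: "h \<in> carrier G \<Longrightarrow> h \<otimes> h [^] (k::nat) = h [^] k \<otimes> h"
  using nat_pow_Suc2[of h k] by simp

lemma axial_power_direction: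
  assumes h: "axial h"
  shows "\<rho> h - gp (inv h) h - \<delta> \<le> gp (h [^] Suc n) h"
proof -
  have hc: "h \<in> carrier G" and b: "0 \<le> gp (inv h) h"
    using h by (auto simp: axial_def gp_nonneg)
  have "foldr (\<otimes>) (replicate k h) \<one> = h [^] k" for k :: nat
    using hc by (induction k) (simp_all add: pow_comm_self)
  moreover have "successively (\<lambda>u v. gp (inv u) v \<le> gp (inv h) h) (replicate (Suc n) h)"
    by (induction n) auto
  moreover have "set (replicate (Suc n) h) \<subseteq> carrier G"
    using hc by auto
  moreover have "2 * gp (inv h) h + 2 * \<delta> < \<rho> u" if "u \<in> set (replicate (Suc n) h)" for u
    using that h delta_nonneg by (auto simp: axial_def)
  ultimately show ?thesis
    using local_to_global[of "replicate (Suc n) h" "gp (inv h) h"] hc b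
    by (simp add: pow_comm_self)
qed

lemma axial_opposite_powers:
  fixes i j :: nat
  assumes h: "axial h"
  shows "gp (inv (h [^] i)) (h [^] j) \<le> gp (inv h) h + 2 * \<delta>"
proof (cases "i = 0 \<or> j = 0")
  case True
  have "h \<in> carrier G"
    using h by (simp add: axial_def)
  then have "0 \<le> gp (inv h) h"
    by (simp add: gp_nonneg)
  moreover have "gp (inv (h [^] i)) (h [^] j) = 0"
    using True \<open>h \<in> carrier G\<close> by (auto simp: length_product_def length_one length_inv)
  ultimately show ?thesis
    using delta_nonneg by simp
next
  case False
  then obtain i' j' where ij: "i = Suc i'" "j = Suc j'"
    by (metis not0_implies_Suc)
  have hc: "h \<in> carrier G" and long: "2 * gp (inv h) h + 4 * \<delta> + 1 \<le> \<rho> h"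
    using h by (auto simp: axial_def)
  let ?x = "inv (h [^] i)" and ?y = "h [^] j"
  have x: "?x = inv h [^] Suc i'"
    using hc by (simp only: ij nat_pow_inv)
  have 1: "\<rho> h - gp (inv h) h - \<delta> \<le> gp ?x (inv h)"
    using axial_power_direction[OF axial_inv[OF h], of i'] hc gp_commute[of h "inv h"]
    unfolding x by (simp add: length_inv del: nat_pow_Suc)
  have 2: "\<rho> h - gp (inv h) h - \<delta> \<le> gp ?y h"
    using axial_power_direction[OF h, of j'] ij by simp
  have "min (gp (inv h) ?x) (gp ?x h) - \<delta> \<le> gp (inv h) h"
    "min (gp ?x ?y) (gp ?y h) - \<delta> \<le> gp ?x h"
    using hc by (auto intro!: hyperbolicity)
  then show ?thesis
    using 1 2 long gp_commute[of ?x "inv h"] hc delta_nonneg by simp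
qed

lemma axial_length_power_ge:
  assumes h: "axial h"
  shows "real n \<le> \<rho> (h [^] n)"
proof (induction n)
  case (Suc n)
  have hc: "h \<in> carrier G" and long: "2 * gp (inv h) h + 4 * \<delta> + 1 \<le> \<rho> h"
    using h by (auto simp: axial_def)
  have "\<rho> (h [^] n \<otimes> h) = \<rho> (h [^] n) + \<rho> h - 2 * gp (inv (h [^] n)) h"
    using hc by (simp add: length_mult_gp)
  moreover have "gp (inv (h [^] n)) h \<le> gp (inv h) h + 2 * \<delta>"
    using axial_opposite_powers[OF h, of n 1] hc by simp
  ultimately show ?case
    using Suc long by simp
qed (simp add: length_one)

lemma length_power_le:
  "h \<in> carrier G \<Longrightarrow> \<rho> (h [^] (n::nat)) \<le> n * \<rho> h"
proof (induction n)
  case (Suc n)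
  then show ?case
    using length_mult[of "h [^] n" h] by (simp add: algebra_simps)
qed (simp add: length_one)

lemma axial_power_on_axis:
  fixes i p :: nat
  assumes h: "axial h" and "i \<le> p"
  shows "\<rho> (h [^] i) - gp (inv h) h - 2 * \<delta> \<le> gp (h [^] p) (h [^] i)"
proof -
  have hc: "h \<in> carrier G"
    using h by (simp add: axial_def)
  have "h [^] p = h [^] i \<otimes> h [^] (p - i)"
    using \<open>i \<le> p\<close> hc by (simp add: nat_pow_mult)
  then show ?thesis
    using gp_mult_left[of "h [^] i" "h [^] (p - i)"] axial_opposite_powers[OF h, of i "p - i"] hc
    by simp
qed

text \<open>
  The points \<open>x\<^sup>i\<close> lie near the path to \<open>x\<^sup>p\<close>, and the points \<open>a y\<^sup>i\<close> near the path to
  \<open>a y\<^sup>q\<close>. Since \<open>x\<^sup>i\<close> and \<open>y\<^sup>i\<close> have the same length, these two points are at the same distance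
  from the base point up to \<open>\<rho> a\<close>, so they are close as long as the two paths run together.
\<close>

lemma axes_fellow_travel:
  fixes i p q :: nat
  assumes h: "axial h" and x: "x \<in> {h, inv h}" and y: "y \<in> {h, inv h}"
    and a: "a \<in> carrier G" and i: "i \<le> p" "i \<le> q"
    and gp: "i * \<rho> h \<le> gp (x [^] p) (a \<otimes> y [^] q)"
  shows "\<rho> (inv (x [^] i) \<otimes> a \<otimes> y [^] i) \<le> 3 * \<rho> a + 2 * gp (inv h) h + 8 * \<delta>"
proof -
  have hc: "h \<in> carrier G"
    using h by (simp add: axial_def)
  have props: "axial z \<and> z \<in> carrier G \<and> gp (inv z) z = gp (inv h) h \<and>
      \<rho> (z [^] i) = \<rho> (h [^] i)" if "z \<in> {h, inv h}" for z
    using that h axial_inv[OF h] hc gp_commute[of h "inv h"] length_inv[of "h [^] i"]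
    by (auto simp: nat_pow_inv)
  note X = props[OF x] and Y = props[OF y]
  let ?b = "gp (inv h) h + 2 * \<delta>"
  have 1: "\<rho> (h [^] i) - ?b \<le> gp (x [^] i) (x [^] p)"
    using axial_power_on_axis[of x i p] X i gp_commute[of "x [^] i" "x [^] p"] by simp
  have 2: "\<rho> (h [^] i) \<le> gp (x [^] p) (a \<otimes> y [^] q)"
    using length_power_le[OF hc, of i] gp by linarith
  have "\<rho> (h [^] i) - ?b - \<rho> a \<le> gp (a \<otimes> y [^] q) (a \<otimes> y [^] i)"
    using axial_power_on_axis[of y i q] Y i gp_translate[of "y [^] q" a "y [^] i"] a by simp
  moreover have "min (gp (x [^] i) (x [^] p)) (gp (x [^] p) (a \<otimes> y [^] i)) - \<delta>
        \<le> gp (x [^] i) (a \<otimes> y [^] i)"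
      "min (gp (x [^] p) (a \<otimes> y [^] q)) (gp (a \<otimes> y [^] q) (a \<otimes> y [^] i)) - \<delta>
        \<le> gp (x [^] p) (a \<otimes> y [^] i)"
    using X Y a by (auto intro!: hyperbolicity)
  moreover have "0 \<le> gp (inv h) h" "0 \<le> \<rho> a"
    using hc a by (auto simp: gp_nonneg length_nonneg)
  ultimately have "\<rho> (h [^] i) - ?b - \<rho> a - 2 * \<delta> \<le> gp (x [^] i) (a \<otimes> y [^] i)"
    using 1 2 delta_nonneg by linarith
  moreover have "\<rho> (a \<otimes> y [^] i) \<le> \<rho> a + \<rho> (h [^] i)"
    using length_mult[of a "y [^] i"] a Y by simp
  moreover have "2 * gp (x [^] i) (a \<otimes> y [^] i) =
      \<rho> (h [^] i) + \<rho> (a \<otimes> y [^] i) - \<rho> (inv (x [^] i) \<otimes> a \<otimes> y [^] i)"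
    using X Y a by (simp add: length_product_def m_assoc)
  ultimately show ?thesis
    by linarith
qed

text \<open>
  For an action with base point \<open>o\<close>, the length of \<open>z\<^sup>-\<^sup>1 g z\<close> is the distance by which \<open>g\<close> moves
  the point \<open>z o\<close>. So this is acylindricity for pairs of points of one orbit.
\<close>

definition acylindrical_length :: bool where
  "acylindrical_length \<longleftrightarrow> (\<forall>\<epsilon>>0. \<exists>R (N::nat). \<forall>z\<in>carrier G. R \<le> \<rho> z \<longrightarrow>
     finite {g \<in> carrier G. \<rho> g \<le> \<epsilon> \<and> \<rho> (inv z \<otimes> g \<otimes> z) \<le> \<epsilon>} \<and>
     card {g \<in> carrier G. \<rho> g \<le> \<epsilon> \<and> \<rho> (inv z \<otimes> g \<otimes> z) \<le> \<epsilon>} \<le> N)"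

lemma power_intertwine:
  fixes t k :: nat
  assumes "x \<in> carrier G" "y \<in> carrier G" "a \<in> carrier G" "x [^] t \<otimes> a = a \<otimes> y [^] t"
  shows "x [^] (t * k) \<otimes> a = a \<otimes> y [^] (t * k)"
proof (induction k)
  case (Suc k)
  have pow: "z [^] (t * Suc k) = z [^] (t * k) \<otimes> z [^] t" if "z \<in> carrier G" for z
    using that by (simp add: nat_pow_mult add.commute)
  have "x [^] (t * Suc k) \<otimes> a = x [^] (t * k) \<otimes> (x [^] t \<otimes> a)"
    using assms by (simp only: pow m_assoc nat_pow_closed)
  also have "\<dots> = x [^] (t * k) \<otimes> a \<otimes> y [^] t"
    using assms(1-3) by (simp add: assms(4) m_assoc)
  also have "\<dots> = a \<otimes> y [^] (t * Suc k)"
    using assms(1-3) by (simp only: Suc pow m_assoc nat_pow_closed)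
  finally show ?case .
qed (use assms in simp)

text \<open>
  If the axes run together for long, then the elements \<open>u i = x\<^sup>-\<^sup>i a y\<^sup>i\<close> for many \<open>i\<close> move two
  distant points of the axis in the same way up to a bounded error. By acylindricity two of them
  agree, with indices that differ by at most \<open>N\<close>, so \<open>a\<close> intertwines the powers of exponent \<open>N!\<close>.
  Both signs of \<open>x\<close> and \<open>y\<close> are needed, as a word contains positive and negative powers.
\<close>

lemma parallel_or_divergent:
  assumes acyl: acylindrical_length and h: "axial h"
  obtains M I :: nat and B :: real where "0 < M" "0 \<le> B"
    "\<And>x y a p q. x \<in> {h, inv h} \<Longrightarrow> y \<in> {h, inv h} \<Longrightarrow> a \<in> carrier G \<Longrightarrow> \<rho> a \<le> C \<Longrightarrow>
      I \<le> p \<Longrightarrow> I \<le> q \<Longrightarrow> B < gp (x [^] p) (a \<otimes> y [^] q) \<Longrightarrow> x [^] M \<otimes> a = a \<otimes> y [^] M"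
proof -
  have hc: "h \<in> carrier G"
    using h by (simp add: axial_def)
  define D where "D = 3 * \<bar>C\<bar> + 2 * gp (inv h) h + 8 * \<delta> + 1"
  have "0 < 2 * D"
    using gp_nonneg[of "inv h" h] hc delta_nonneg by (simp add: D_def)
  then obtain R and N :: nat where RN: "\<And>z. z \<in> carrier G \<Longrightarrow> R \<le> \<rho> z \<Longrightarrow>
      finite {g \<in> carrier G. \<rho> g \<le> 2 * D \<and> \<rho> (inv z \<otimes> g \<otimes> z) \<le> 2 * D} \<and>
      card {g \<in> carrier G. \<rho> g \<le> 2 * D \<and> \<rho> (inv z \<otimes> g \<otimes> z) \<le> 2 * D} \<le> N"
    using acyl unfolding acylindrical_length_def by meson
  define r where "r = nat \<lceil>R\<rceil>"
  define I where "I = r + N"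
  have "x [^] (fact N :: nat) \<otimes> a = a \<otimes> y [^] (fact N :: nat)"
    if x: "x \<in> {h, inv h}" and y: "y \<in> {h, inv h}" and a: "a \<in> carrier G" "\<rho> a \<le> C"
      and pq: "I \<le> p" "I \<le> q" and gp: "I * \<rho> h < gp (x [^] p) (a \<otimes> y [^] q)" for x y a p q
  proof -
    have xy: "x \<in> carrier G" "y \<in> carrier G"
      using x y hc by auto
    define u where "u i = inv (x [^] i) \<otimes> a \<otimes> y [^] i" for i :: nat
    have u_closed: "u i \<in> carrier G" for i
      using xy a by (simp add: u_def)
    have u_le: "\<rho> (u i) \<le> D" if "i \<le> I" for i
    proof -
      have "i * \<rho> h \<le> I * \<rho> h"
        using that length_nonneg[OF hc] by (intro mult_right_mono) auto
      then have "\<rho> (u i) \<le> 3 * \<rho> a + 2 * gp (inv h) h + 8 * \<delta>"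
        unfolding u_def using that pq gp by (intro axes_fellow_travel[OF h x y a(1), of i p q]) auto
      then show ?thesis
        using a by (simp add: D_def)
    qed
    let ?z = "x [^] r"
    let ?S = "{g \<in> carrier G. \<rho> g \<le> 2 * D \<and> \<rho> (inv ?z \<otimes> g \<otimes> ?z) \<le> 2 * D}"
    have "axial x"
      using x h axial_inv by auto
    then have "R \<le> \<rho> ?z"
      using axial_length_power_ge[of x r] real_nat_ceiling_ge[of R] by (simp add: r_def)
    then have S: "finite ?S" "card ?S \<le> N"
      using RN[of ?z] xy by auto
    have shift: "inv ?z \<otimes> u i \<otimes> y [^] r = u (i + r)" for i
    proof -
      have "inv (x [^] (i + r)) = inv ?z \<otimes> inv (x [^] i)"
        using xy by (simp add: inv_mult_group flip: nat_pow_mult)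
      then show ?thesis
        using xy a by (simp add: u_def m_assoc flip: nat_pow_mult)
    qed
    \<comment> \<open>If the two axes are oriented oppositely then \<open>u i\<close> exchanges far points of them,
      so only the quotients of two such elements nearly fix a pair of distant points.\<close>
    define v where "v i = u i \<otimes> inv (u 0)" for i
    have "v ` {..N} \<subseteq> ?S"
    proof
      fix g assume "g \<in> v ` {..N}"
      then obtain i where i: "i \<le> N" "g = v i"
        by auto
      have "\<rho> g \<le> \<rho> (u i) + \<rho> (u 0)"
        using length_mult[of "u i" "inv (u 0)"] u_closed by (simp add: i v_def length_inv)
      then have 1: "\<rho> g \<le> 2 * D"
        using u_le[of i] u_le[of 0] i by (simp add: I_def)
      have "inv ?z \<otimes> g \<otimes> ?z = (inv ?z \<otimes> u i \<otimes> y [^] r) \<otimes> inv (inv ?z \<otimes> u 0 \<otimes> y [^] r)"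
        using xy u_closed by (simp add: i v_def inv_mult_group m_assoc mult_inv_cancel)
      also have "\<dots> = u (i + r) \<otimes> inv (u r)"
        using shift[of i] shift[of 0] by simp
      finally have "\<rho> (inv ?z \<otimes> g \<otimes> ?z) \<le> \<rho> (u (i + r)) + \<rho> (u r)"
        using length_mult[of "u (i + r)" "inv (u r)"] u_closed by (simp add: length_inv)
      then have 2: "\<rho> (inv ?z \<otimes> g \<otimes> ?z) \<le> 2 * D"
        using u_le[of "i + r"] u_le[of r] i by (simp add: I_def)
      show "g \<in> ?S"
        using 1 2 u_closed i by (simp add: v_def)
    qed
    then have "card (v ` {..N}) \<le> N"
      using card_mono[OF S(1)] S(2) by (meson le_trans)
    then have "\<not> inj_on v {..N}"
      using card_image[of v "{..N}"] by auto
    then obtain i j where ij: "i < j" "j \<le> N" "v i = v j"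
      unfolding inj_on_def by (metis atMost_iff linorder_neqE_nat)
    then have "u i = u j"
      using u_closed by (simp add: v_def)
    then have eq: "inv (x [^] i) \<otimes> (a \<otimes> y [^] i) = inv (x [^] j) \<otimes> (a \<otimes> y [^] j)"
      using xy a by (simp add: u_def m_assoc)
    have j: "x [^] j = x [^] (j - i) \<otimes> x [^] i" "y [^] j = y [^] (j - i) \<otimes> y [^] i"
      using ij xy by (simp_all add: nat_pow_mult)
    have "x [^] (j - i) \<otimes> a \<otimes> y [^] i = x [^] j \<otimes> (inv (x [^] i) \<otimes> (a \<otimes> y [^] i))"
      using xy a j by (simp add: m_assoc mult_inv_cancel)
    also have "\<dots> = a \<otimes> y [^] (j - i) \<otimes> y [^] i"
      using xy a j by (simp add: eq mult_inv_cancel) (simp add: m_assoc)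
    finally have "x [^] (j - i) \<otimes> a = a \<otimes> y [^] (j - i)"
      using xy a by simp
    moreover have "j - i dvd fact N"
      using ij by (intro dvd_fact) auto
    ultimately show ?thesis
      using power_intertwine[OF xy a(1)] by (metis dvdE)
  qed
  moreover have "0 \<le> I * \<rho> h"
    using length_nonneg[OF hc] by simp
  ultimately show ?thesis
    using that[of "fact N" "I * \<rho> h" I] by simp
qed

end

section \<open>Words evaluated at powers of an axial element\<close>

context hyperbolic_length
begin

definition word_length :: "('a \<times> int) list \<Rightarrow> real" where
  "word_length w = (\<Sum>p\<leftarrow>w. \<rho> (fst p))"

text \<open>
  With \<open>E\<close> the set of coefficients that can be moved past a power of the variable, a normal word
  is one in which no two neighbouring powers can be merged. The first coefficient does not lie
  between two powers and is therefore unrestricted.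
\<close>

definition normal_word :: "'a set \<Rightarrow> ('a \<times> int) list \<Rightarrow> bool" where
  "normal_word E w \<longleftrightarrow> set w \<subseteq> carrier G \<times> (- {0}) \<and> successively (\<lambda>p q. fst q \<notin> E) w"

text \<open>
  The elements that can be moved past \<open>g\<close> at the price of a sign in the exponent.
\<close>

definition power_normalizer :: "'a \<Rightarrow> 'a set" where
  "power_normalizer g = {a \<in> carrier G. g \<otimes> a = a \<otimes> g \<or> g \<otimes> a = a \<otimes> inv g}"

lemma word_length_simps [simp]:
  "word_length [] = 0"
  "word_length (p # w) = \<rho> (fst p) + word_length w"
  by (simp_all add: word_length_def)

lemma word_length_nonneg: "set w \<subseteq> carrier G \<times> UNIV \<Longrightarrow> 0 \<le> word_length w"
  by (induction w) (auto simp: length_nonneg)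

lemma word_length_ge_coefficient:
  "set w \<subseteq> carrier G \<times> UNIV \<Longrightarrow> p \<in> set w \<Longrightarrow> \<rho> (fst p) \<le> word_length w"
proof (induction w)
  case (Cons q w)
  then have "0 \<le> word_length w" "0 \<le> \<rho> (fst q)"
    using word_length_nonneg[of w] by (auto simp: length_nonneg)
  with Cons show ?case
    by (auto intro: order_trans)
qed simp

lemma normal_word_carrier: "normal_word E w \<Longrightarrow> set w \<subseteq> carrier G \<times> UNIV"
  by (auto simp: normal_word_def)

lemma normal_word_Cons:
  "normal_word E (p # w) \<longleftrightarrow>
     fst p \<in> carrier G \<and> snd p \<noteq> 0 \<and> normal_word E w \<and> (w \<noteq> [] \<longrightarrow> fst (hd w) \<notin> E)"
  by (cases p) (auto simp: normal_word_def successively_Cons)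

lemma int_pow_commute_or_invert:
  fixes n :: int
  assumes g: "g \<in> carrier G" and a: "a \<in> power_normalizer g"
  obtains \<sigma> :: int where "\<And>n :: int. g [^] n \<otimes> a = a \<otimes> g [^] (\<sigma> * n)"
proof -
  have ac: "a \<in> carrier G"
    using a by (simp add: power_normalizer_def)
  obtain \<sigma> :: int where \<sigma>: "g \<otimes> a = a \<otimes> g [^] \<sigma>"
  proof (cases "g \<otimes> a = a \<otimes> g")
    case True
    then show ?thesis
      using that[of 1] g by simp
  next
    case False
    then show ?thesis
      using a that[of "-1"] g by (simp add: power_normalizer_def int_pow_neg)
  qed
  have nat: "g [^] int n \<otimes> a = a \<otimes> g [^] (\<sigma> * int n)" for n
  proof (induction n)
    case (Suc n)
    have "g [^] int (Suc n) \<otimes> a = g [^] int n \<otimes> (g \<otimes> a)"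
      using g ac by (simp only: int_pow_int nat_pow_Suc m_assoc nat_pow_closed)
    also have "\<dots> = (g [^] int n \<otimes> a) \<otimes> g [^] \<sigma>"
      using g ac \<sigma> by (simp add: m_assoc)
    also have "\<dots> = a \<otimes> g [^] (\<sigma> * int n + \<sigma>)"
      using g ac Suc by (simp add: m_assoc int_pow_mult)
    also have "\<sigma> * int n + \<sigma> = \<sigma> * int (Suc n)"
      by (simp add: distrib_left)
    finally show ?case .
  qed (use g ac in simp)
  have "g [^] n \<otimes> a = a \<otimes> g [^] (\<sigma> * n)" for n :: int
  proof (cases "0 \<le> n")
    case True
    then show ?thesis
      using nat[of "nat n"] by simp
  next
    case False
    define k where "k = nat (- n)"
    have n: "n = - int k"
      using False by (simp add: k_def)
    let ?P = "g [^] int k" and ?Q = "g [^] (\<sigma> * int k)"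
    have "?P \<otimes> (a \<otimes> inv ?Q) = (?P \<otimes> a) \<otimes> inv ?Q"
      using g ac by (simp add: m_assoc)
    also have "\<dots> = a"
      using g ac by (simp only: nat) (simp add: m_assoc)
    finally have "inv ?P \<otimes> a = a \<otimes> inv ?Q"
      using g ac mult_inv_cancel(2)[of ?P "a \<otimes> inv ?Q"] by simp
    then show ?thesis
      using g by (simp add: n int_pow_neg)
  qed
  then show ?thesis
    using that by blast
qed

lemma normal_word_mult_left:
  assumes ws: "normal_word E ws" and b: "b \<in> carrier G" and c: "c \<in> carrier G"
  obtains ws' b' where "normal_word E ws'" "b' \<in> carrier G"
    "word_length ws' + \<rho> b' \<le> \<rho> c + (word_length ws + \<rho> b)"
    "\<And>x. x \<in> carrier G \<Longrightarrow> word_value G x ws' \<otimes> b' = c \<otimes> (word_value G x ws \<otimes> b)"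
proof (cases ws)
  case Nil
  show ?thesis
    by (rule that[of "[]" "c \<otimes> b"])
      (use Nil b c length_mult[of c b] in \<open>auto simp: normal_word_def\<close>)
next
  case (Cons p r)
  obtain a n where p: "p = (a, n)"
    by (cases p)
  have a: "a \<in> carrier G" "set r \<subseteq> carrier G \<times> UNIV"
    using ws Cons p by (auto simp: normal_word_def)
  show ?thesis
  proof (rule that[of "(c \<otimes> a, n) # r" b])
    show "normal_word E ((c \<otimes> a, n) # r)"
      using ws c a by (auto simp: Cons p normal_word_Cons)
    show "word_length ((c \<otimes> a, n) # r) + \<rho> b \<le> \<rho> c + (word_length ws + \<rho> b)"
      using length_mult[OF c a(1)] by (simp add: Cons p)
    show "word_value G x ((c \<otimes> a, n) # r) \<otimes> b = c \<otimes> (word_value G x ws \<otimes> b)"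
      if "x \<in> carrier G" for x
      using that a b c by (simp add: Cons p m_assoc)
  qed (rule b)
qed

text \<open>
  Normal words are obtained by inserting one syllable after another at the left. A new syllable is
  merged with the next one if the coefficient between them lies in the power normalizer of \<open>g\<close>,
  and if the exponents cancel then the coefficients are collected to the left. The values at \<open>g\<close>
  and at \<open>1\<close> do not change, and the total length of the coefficients does not grow. It is this
  bound, rather than one on the single coefficients, that survives the merging.
\<close>

lemma ex_normal_word:
  assumes g: "g \<in> carrier G" and w: "set w \<subseteq> carrier G \<times> UNIV"
  obtains ws b where "normal_word (power_normalizer g) ws" "b \<in> carrier G"
    "word_length ws + \<rho> b \<le> word_length w"
    "word_value G g ws \<otimes> b = word_value G g w" "word_value G \<one> ws \<otimes> b = word_value G \<one> w"
proof -
  let ?E = "power_normalizer g"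
  have "\<exists>ws b. normal_word ?E ws \<and> b \<in> carrier G \<and> word_length ws + \<rho> b \<le> word_length w \<and>
      (\<forall>x\<in>{g, \<one>}. word_value G x ws \<otimes> b = word_value G x w)"
    using w
  proof (induction w)
    case Nil
    show ?case
      by (intro exI[of _ "[]"] exI[of _ \<one>]) (auto simp: normal_word_def length_one)
  next
    case (Cons p w)
    obtain a n where p: "p = (a, n)"
      by (cases p)
    have a: "a \<in> carrier G" and w: "set w \<subseteq> carrier G \<times> UNIV"
      using Cons.prems p by auto
    obtain ws b where ws: "normal_word ?E ws" and b: "b \<in> carrier G"
      and len: "word_length ws + \<rho> b \<le> word_length w"
      and val: "\<And>x. x \<in> {g, \<one>} \<Longrightarrow> word_value G x ws \<otimes> b = word_value G x w"
      using Cons.IH[OF w] by blast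
    consider "n = 0" | "n \<noteq> 0" "ws \<noteq> [] \<longrightarrow> fst (hd ws) \<notin> ?E"
      | "n \<noteq> 0" "ws \<noteq> []" "fst (hd ws) \<in> ?E"
      by blast
    then show ?case
    proof cases
      case 1
      obtain ws' b' where "normal_word ?E ws'" "b' \<in> carrier G"
          "word_length ws' + \<rho> b' \<le> \<rho> a + (word_length ws + \<rho> b)"
          "\<And>x. x \<in> carrier G \<Longrightarrow> word_value G x ws' \<otimes> b' = a \<otimes> (word_value G x ws \<otimes> b)"
        using normal_word_mult_left[OF ws b a] by blast
      then show ?thesis
        using len val g a by (intro exI[of _ ws'] exI[of _ b']) (auto simp: p 1)
    next
      case 2
      have "word_value G x ((a, n) # ws) \<otimes> b = word_value G x (p # w)" if "x \<in> {g, \<one>}" for x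
        using that val[OF that] a g b w normal_word_carrier[OF ws] by (auto simp: p m_assoc)
      moreover have "normal_word ?E ((a, n) # ws)"
        using 2 ws a by (simp add: normal_word_Cons)
      moreover have "word_length ((a, n) # ws) + \<rho> b \<le> word_length (p # w)"
        using len by (simp add: p)
      ultimately show ?thesis
        using b by blast
    next
      case 3
      then obtain a' n' r where r: "ws = (a', n') # r"
        by (metis list.exhaust_sel prod.exhaust)
      have a': "a' \<in> carrier G" "a' \<in> ?E" and nr: "normal_word ?E r"
        using 3 ws r by (auto simp: normal_word_Cons)
      note rc = normal_word_carrier[OF nr]
      obtain \<sigma> :: int where \<sigma>: "\<And>n :: int. g [^] n \<otimes> a' = a' \<otimes> g [^] (\<sigma> * n)"
        using int_pow_commute_or_invert[OF g a'(2)] by blast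
      define m where "m = \<sigma> * n + n'"
      have merge: "word_value G x ((a \<otimes> a', m) # r) \<otimes> b = word_value G x (p # w)"
        if x: "x \<in> {g, \<one>}" for x
      proof -
        have xc: "x \<in> carrier G"
          using x g by auto
        have "x [^] n \<otimes> a' = a' \<otimes> x [^] (\<sigma> * n)"
          using x \<sigma>[of n] a' by auto
        then have "a \<otimes> x [^] n \<otimes> (a' \<otimes> x [^] n') = a \<otimes> a' \<otimes> x [^] m"
          using a a' xc by (simp add: m_def int_pow_mult flip: m_assoc) (simp add: m_assoc)
        then have "a \<otimes> x [^] n \<otimes> (word_value G x ws \<otimes> b) = word_value G x ((a \<otimes> a', m) # r) \<otimes> b"
          using a a' xc rc b by (simp add: r flip: m_assoc)
        then show ?thesis
          using val[OF x] by (simp add: p)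
      qed
      have len': "\<rho> (a \<otimes> a') + word_length r + \<rho> b \<le> word_length (p # w)"
        using len length_mult[OF a a'(1)] by (simp add: p r)
      show ?thesis
      proof (cases "m = 0")
        case True
        have "a \<otimes> a' \<in> carrier G"
          using a a' by simp
        then obtain ws' b' where *: "normal_word ?E ws'" "b' \<in> carrier G"
            "word_length ws' + \<rho> b' \<le> \<rho> (a \<otimes> a') + (word_length r + \<rho> b)"
            "\<And>x. x \<in> carrier G \<Longrightarrow>
              word_value G x ws' \<otimes> b' = (a \<otimes> a') \<otimes> (word_value G x r \<otimes> b)"
          using normal_word_mult_left[OF nr b] by blast
        have "word_value G x ws' \<otimes> b' = word_value G x (p # w)" if x: "x \<in> {g, \<one>}" for x
          using *(4)[of x] merge[OF x] x g a a' rc b True by (auto simp: m_assoc)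
        then show ?thesis
          using *(1-3) len' by (intro exI[of _ ws'] exI[of _ b']) auto
      next
        case False
        then have "normal_word ?E ((a \<otimes> a', m) # r)"
          using ws r a a' by (auto simp: normal_word_Cons)
        then show ?thesis
          using merge b len' by (intro exI[of _ "(a \<otimes> a', m) # r"] exI[of _ b]) simp
      qed
    qed
  qed
  then show ?thesis
    using that by auto
qed

text \<open>
  The syllables are the sides of a broken path. Shortening a side by its coefficient changes the
  backtracking at a corner by at most \<open>C\<close>, so \<open>local_to_global\<close> applies with \<open>B + C\<close>, and the path
  ends too far from its origin for \<open>b\<close> to lead back.
\<close>

lemma normal_word_nontrivial:
  assumes g: "g \<in> carrier G" and "0 \<le> B" "0 \<le> C"
    and long: "\<And>n :: int. n \<noteq> 0 \<Longrightarrow> 3 * (B + 2 * C + \<delta>) < \<rho> (g [^] n)"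
    and div: "\<And>a n n'. a \<in> carrier G \<Longrightarrow> \<rho> a \<le> C \<Longrightarrow> a \<notin> E \<Longrightarrow> n \<noteq> 0 \<Longrightarrow> n' \<noteq> 0 \<Longrightarrow>
      gp (g [^] (n :: int)) (a \<otimes> g [^] (n' :: int)) \<le> B"
    and ws: "normal_word E ws" "ws \<noteq> []" and b: "b \<in> carrier G"
    and C: "word_length ws + \<rho> b \<le> C"
  shows "word_value G g ws \<otimes> b \<noteq> \<one>"
proof
  assume trivial: "word_value G g ws \<otimes> b = \<one>"
  note wsc = normal_word_carrier[OF ws(1)]
  define syl where "syl p = fst p \<otimes> g [^] snd p" for p :: "'a \<times> int"
  define us where "us = map syl ws"
  have coef: "fst p \<in> carrier G \<and> \<rho> (fst p) \<le> C \<and> snd p \<noteq> 0" if "p \<in> set ws" for p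
    using word_length_ge_coefficient[OF wsc that] C length_nonneg[OF b] ws(1) that
    by (auto simp: normal_word_def)
  have uc: "set us \<subseteq> carrier G"
    using coef g by (auto simp: us_def syl_def)
  have us_long: "3 * (B + 2 * C + \<delta>) - C < \<rho> u" if u: "u \<in> set us" for u
  proof -
    obtain p where p: "p \<in> set ws" "u = syl p"
      using u unfolding us_def set_map by blast
    have "\<rho> (g [^] snd p) \<le> \<rho> (fst p) + \<rho> u"
      using length_mult[of "inv (fst p)" u] coef[OF p(1)] g p(2)
      by (simp add: syl_def length_inv mult_inv_cancel)
    then show ?thesis
      using long[of "snd p"] coef[OF p(1)] by simp
  qed
  have "successively (\<lambda>p q. gp (inv (syl p)) (syl q) \<le> B + C) ws"
  proof (rule successively_mono[of "\<lambda>p q. fst q \<notin> E"])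
    show "successively (\<lambda>p q. fst q \<notin> E) ws"
      using ws(1) by (simp add: normal_word_def)
    fix p q assume pq: "p \<in> set ws" "q \<in> set ws" "fst q \<notin> E"
    have "gp (inv (syl p)) (syl q) = gp (g [^] (- snd p) \<otimes> inv (fst p)) (syl q)"
      using coef[OF pq(1)] g by (simp add: syl_def inv_mult_group int_pow_neg)
    also have "\<dots> \<le> gp (g [^] (- snd p)) (syl q) + \<rho> (fst p)"
      using gp_perturb_right_factor[of "g [^] (- snd p)" "inv (fst p)" "syl q"]
        coef[OF pq(1)] coef[OF pq(2)] g by (simp add: syl_def length_inv)
    also have "\<dots> \<le> B + C"
      using div[of "fst q" "- snd p" "snd q"] coef[OF pq(1)] coef[OF pq(2)] pq(3)
      by (simp add: syl_def)
    finally show "gp (inv (syl p)) (syl q) \<le> B + C" .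
  qed
  then have "successively (\<lambda>u v. gp (inv u) v \<le> B + C) us"
    by (simp add: us_def successively_map)
  moreover have "2 * (B + C) + 2 * \<delta> < \<rho> u" if "u \<in> set us" for u
    using us_long[OF that] \<open>0 \<le> B\<close> \<open>0 \<le> C\<close> delta_nonneg by simp
  ultimately have "\<rho> (hd us) - (B + C) - \<delta> \<le> gp (foldr (\<otimes>) us \<one>) (hd us)"
    using uc ws(2) \<open>0 \<le> B\<close> \<open>0 \<le> C\<close> by (intro local_to_global) (auto simp: us_def)
  also have "\<dots> \<le> \<rho> (foldr (\<otimes>) us \<one>)"
    using uc ws(2) foldr_mult_closed[OF uc] by (intro gp_le) (auto simp: us_def hd_map)
  also have "foldr (\<otimes>) us \<one> = word_value G g ws"
    unfolding us_def by (induction ws) (simp_all add: syl_def)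
  also have "word_value G g ws = inv b"
    using trivial b wsc g by (metis inv_equality inv_inv word_value_closed)
  finally have "\<rho> (hd us) \<le> \<rho> b + B + C + \<delta>"
    using b by (simp add: length_inv)
  moreover have "\<rho> b \<le> C"
    using C word_length_nonneg[OF wsc] by simp
  moreover have "hd us \<in> set us"
    using ws(2) by (cases ws) (simp_all add: us_def)
  ultimately show False
    using us_long[of "hd us"] \<open>0 \<le> B\<close> \<open>0 \<le> C\<close> delta_nonneg by simp
qed

text \<open>
  The witness is \<open>g = h ^ (M m)\<close>, where \<open>M\<close> makes every coefficient whose axis does not diverge an
  element of the power normalizer of \<open>g\<close>, and \<open>m\<close> makes all nontrivial powers of \<open>g\<close> long. There
  is no bound on the exponents or on the number of syllables.
\<close>

theorem ex_word_evading_element: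
  assumes acyl: acylindrical_length and h: "axial h"
  shows "\<exists>g\<in>carrier G. g \<noteq> \<one> \<and> (\<forall>w. set w \<subseteq> carrier G \<times> UNIV \<longrightarrow> word_length w \<le> C \<longrightarrow>
    word_value G g w = \<one> \<longrightarrow> word_value G \<one> w = \<one>)"
proof (cases "0 \<le> C")
  case False
  have "0 < \<rho> h"
    using h gp_nonneg[of "inv h" h] delta_nonneg by (auto simp: axial_def)
  then have "h \<noteq> \<one>"
    using length_one by auto
  moreover have "\<not> word_length w \<le> C" if "set w \<subseteq> carrier G \<times> UNIV" for w
    using word_length_nonneg[OF that] False by linarith
  ultimately show ?thesis
    using h by (intro bexI[of _ h]) (auto simp: axial_def)
next
  case True
  have hc: "h \<in> carrier G"
    using h by (simp add: axial_def)
  obtain M I :: nat and B :: real where M: "0 < M" and B: "0 \<le> B"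
    and par: "\<And>x y a p q. x \<in> {h, inv h} \<Longrightarrow> y \<in> {h, inv h} \<Longrightarrow> a \<in> carrier G \<Longrightarrow> \<rho> a \<le> C \<Longrightarrow>
      I \<le> p \<Longrightarrow> I \<le> q \<Longrightarrow> B < gp (x [^] p) (a \<otimes> y [^] q) \<Longrightarrow> x [^] M \<otimes> a = a \<otimes> y [^] M"
    by (rule parallel_or_divergent[OF acyl h, of C]) (rule that)
  define m where "m = max I (nat \<lceil>3 * (B + 2 * C + \<delta>)\<rceil> + 1)"
  define g where "g = h [^] (M * m)"
  have gc: "g \<in> carrier G"
    using hc by (simp add: g_def)
  have m_le: "m \<le> M * m * nat \<bar>n\<bar>" if "n \<noteq> 0" for n :: int
  proof -
    have "1 \<le> M * nat \<bar>n\<bar>"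
      using M that by (simp add: Suc_le_eq)
    then have "m * 1 \<le> m * (M * nat \<bar>n\<bar>)"
      by (rule mult_left_mono) simp
    then show ?thesis
      by (simp only: mult_1_right mult.assoc mult.commute mult.left_commute)
  qed
  have power: "\<exists>x\<in>{h, inv h}. g [^] n = x [^] (M * m * nat \<bar>n\<bar>) \<and>
      (x = h \<and> 0 \<le> n \<or> x = inv h \<and> n < 0)" for n :: int
  proof (cases "0 \<le> n")
    case True
    have "g [^] int (nat n) = h [^] (M * m * nat n)"
      unfolding int_pow_int g_def by (rule nat_pow_pow[OF hc])
    then have "g [^] n = h [^] (M * m * nat \<bar>n\<bar>)"
      using True by simp
    then show ?thesis
      using True by blast
  next
    case False
    define k where "k = nat (- n)"
    have n: "n = - int k"
      using False by (simp add: k_def)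
    have "g [^] n = inv (g [^] k)"
      unfolding n by (rule int_pow_neg_int[OF gc])
    also have "\<dots> = inv h [^] (M * m * k)"
      unfolding g_def nat_pow_pow[OF hc] by (rule nat_pow_inv[OF hc, symmetric])
    finally have "g [^] n = inv h [^] (M * m * nat \<bar>n\<bar>)"
      by (simp add: n)
    then show ?thesis
      using False by auto
  qed
  have long: "3 * (B + 2 * C + \<delta>) < \<rho> (g [^] n)" if n: "n \<noteq> 0" for n :: int
  proof -
    obtain x where x: "x \<in> {h, inv h}" "g [^] n = x [^] (M * m * nat \<bar>n\<bar>)"
      using power by blast
    have "axial x"
      using x h axial_inv by auto
    then have "real (M * m * nat \<bar>n\<bar>) \<le> \<rho> (g [^] n)"
      unfolding x(2) by (rule axial_length_power_ge)
    moreover have "real m \<le> real (M * m * nat \<bar>n\<bar>)"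
      using m_le[OF n] by (simp only: of_nat_le_iff)
    moreover have "3 * (B + 2 * C + \<delta>) < real m"
    proof -
      have "3 * (B + 2 * C + \<delta>) < real (nat \<lceil>3 * (B + 2 * C + \<delta>)\<rceil> + 1)"
        by linarith
      also have "\<dots> \<le> real m"
        unfolding of_nat_le_iff m_def by (rule max.cobounded2)
      finally show ?thesis .
    qed
    ultimately show ?thesis
      by linarith
  qed
  have div: "gp (g [^] n) (a \<otimes> g [^] n') \<le> B"
    if a: "a \<in> carrier G" "\<rho> a \<le> C" "a \<notin> power_normalizer g" and n: "n \<noteq> 0" "n' \<noteq> 0"
    for a and n n' :: int
  proof (rule ccontr)
    assume "\<not> gp (g [^] n) (a \<otimes> g [^] n') \<le> B"
    moreover obtain x where x: "x \<in> {h, inv h}" "g [^] n = x [^] (M * m * nat \<bar>n\<bar>)"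
      using power by blast
    moreover obtain y where y: "y \<in> {h, inv h}" "g [^] n' = y [^] (M * m * nat \<bar>n'\<bar>)"
      using power by blast
    moreover have "I \<le> m"
      by (simp add: m_def)
    then have "I \<le> M * m * nat \<bar>n\<bar>" "I \<le> M * m * nat \<bar>n'\<bar>"
      using m_le[OF n(1)] m_le[OF n(2)] by linarith+
    ultimately have par': "x [^] M \<otimes> a = a \<otimes> y [^] M"
      using par[OF x(1) y(1) a(1,2)] by simp
    have xc: "x \<in> carrier G" and yc: "y \<in> carrier G"
      using x y hc by auto
    have eq: "x [^] (M * m) \<otimes> a = a \<otimes> y [^] (M * m)"
      by (rule power_intertwine[OF xc yc a(1) par'])
    have pow: "z [^] (M * m) = (if z = h then g else inv g)" if "z \<in> {h, inv h}" for z
      using that hc by (auto simp: g_def nat_pow_inv)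
    have "g \<otimes> a = a \<otimes> g \<or> g \<otimes> a = a \<otimes> inv g"
    proof (cases "x = h")
      case True
      then show ?thesis
        using eq pow[OF x(1)] pow[OF y(1)] by (auto split: if_splits)
    next
      case False
      define Y where "Y = y [^] (M * m)"
      have Y: "Y \<in> carrier G"
        using yc by (simp add: Y_def)
      have "inv g \<otimes> a = a \<otimes> Y"
        using False eq pow[OF x(1)] by (simp add: Y_def)
      then have "g \<otimes> a \<otimes> Y = a"
        using gc a(1) Y mult_inv_cancel(1)[of g a] by (simp add: m_assoc)
      then have "g \<otimes> a = a \<otimes> inv Y"
        using inv_solve_right[of "g \<otimes> a" a Y] gc a(1) Y by simp
      then have "g \<otimes> a = a \<otimes> inv (y [^] (M * m))"
        by (simp only: Y_def)
      then show ?thesis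
        using pow[OF y(1)] gc by (auto split: if_splits)
    qed
    then show False
      using a by (simp add: power_normalizer_def)
  qed
  show ?thesis
  proof (intro bexI[of _ g] conjI allI impI)
    show "g \<noteq> \<one>"
      using long[of 1] B True delta_nonneg gc by (auto simp: length_one)
    fix w assume w: "set w \<subseteq> carrier G \<times> UNIV" "word_length w \<le> C" "word_value G g w = \<one>"
    obtain ws b where ws: "normal_word (power_normalizer g) ws" "b \<in> carrier G"
        "word_length ws + \<rho> b \<le> word_length w"
        "word_value G g ws \<otimes> b = word_value G g w" "word_value G \<one> ws \<otimes> b = word_value G \<one> w"
      using ex_normal_word[OF gc w(1)] by blast
    have "ws = []"
    proof (rule ccontr)
      assume "ws \<noteq> []"
      then have "word_value G g ws \<otimes> b \<noteq> \<one>"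
        using ws(3) w(2) by (intro normal_word_nontrivial[OF gc B True long div ws(1) _ ws(2)]) simp_all
      then show False
        using ws(4) w(3) by simp
    qed
    then show "word_value G \<one> w = \<one>"
      using ws w by simp
  qed (rule gc)
qed

end

section \<open>Acylindrical actions on hyperbolic spaces\<close>

definition gromov_product :: "('s \<Rightarrow> 's \<Rightarrow> real) \<Rightarrow> 's \<Rightarrow> 's \<Rightarrow> 's \<Rightarrow> real" where
  "gromov_product d w x y = (d w x + d w y - d x y) / 2"

context Metric_space
begin

lemma geodesic_segment_point:
  assumes "geodesic_segment M d x y A" "p \<in> A"
  shows "p \<in> M" "d x p + d p y = d x y"
proof -
  obtain l \<gamma> where \<gamma>: "0 \<le> l" "\<gamma> ` {0..l} \<subseteq> M" "\<gamma> 0 = x" "\<gamma> l = y" "A = \<gamma> ` {0..l}"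
      and iso: "\<And>s t. s \<in> {0..l} \<Longrightarrow> t \<in> {0..l} \<Longrightarrow> d (\<gamma> s) (\<gamma> t) = \<bar>s - t\<bar>"
    using assms(1) unfolding geodesic_segment_def by blast
  obtain s where s: "s \<in> {0..l}" "p = \<gamma> s"
    using assms(2) \<gamma> by auto
  show "p \<in> M"
    using s \<gamma> by auto
  show "d x p + d p y = d x y"
    using iso[of 0 s] iso[of s l] iso[of 0 l] s \<gamma> by auto
qed

lemma geodesic_segment_ends:
  assumes "geodesic_segment M d x y A"
  shows "x \<in> A" "y \<in> A"
  using assms unfolding geodesic_segment_def by (metis atLeastAtMost_iff imageI order_refl)+

lemma geodesic_segment_points_at:
  assumes "geodesic_segment M d x y A" "0 \<le> s" "s \<le> t" "t \<le> d x y"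
  obtains p q where "p \<in> A" "q \<in> A" "d x p = s" "d x q = t" "d p q = t - s"
proof -
  obtain l \<gamma> where \<gamma>: "0 \<le> l" "\<gamma> 0 = x" "\<gamma> l = y" "A = \<gamma> ` {0..l}"
      and iso: "\<And>s t. s \<in> {0..l} \<Longrightarrow> t \<in> {0..l} \<Longrightarrow> d (\<gamma> s) (\<gamma> t) = \<bar>s - t\<bar>"
    using assms(1) unfolding geodesic_segment_def by blast
  have l: "d x y = l"
    using iso[of 0 l] \<gamma> by auto
  show ?thesis
    by (rule that[of "\<gamma> s" "\<gamma> t"])
      (use iso[of 0 s] iso[of 0 t] iso[of s t] \<gamma> l assms in auto)
qed

lemma gromov_product_le_dist_geodesic:
  assumes "geodesic_segment M d y z A" "p \<in> A" "x \<in> M" "y \<in> M" "z \<in> M"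
  shows "gromov_product d x y z \<le> d x p"
proof -
  have "p \<in> M" "d y p + d p z = d y z"
    using geodesic_segment_point[OF assms(1,2)] by auto
  then show ?thesis
    using triangle[of x p y] triangle[of x p z] assms commute[of p y]
    by (simp add: gromov_product_def)
qed

text \<open>
  The points of the side near \<open>C\<close> and those near \<open>B\<close> cover it, and its two ends belong one to
  each set. Near the supremum of the parameters of the first kind there are points of both kinds;
  an error of \<open>1\<close> is allowed for not reaching the supremum.
\<close>

lemma slim_point_near_both:
  assumes A: "geodesic_segment M d y z A" and "y \<in> C" "z \<in> B" "0 \<le> \<delta>"
    and slim: "\<And>p. p \<in> A \<Longrightarrow> \<exists>q\<in>B \<union> C. d p q \<le> \<delta>" and BC: "B \<subseteq> M" "C \<subseteq> M"
  obtains p q r where "p \<in> A" "q \<in> B" "r \<in> C" "d p q \<le> \<delta> + 1" "d p r \<le> \<delta> + 1"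
proof -
  obtain l \<gamma> where \<gamma>: "0 \<le> l" "\<gamma> ` {0..l} \<subseteq> M" "\<gamma> 0 = y" "\<gamma> l = z" "A = \<gamma> ` {0..l}"
      and iso: "\<And>s t. s \<in> {0..l} \<Longrightarrow> t \<in> {0..l} \<Longrightarrow> d (\<gamma> s) (\<gamma> t) = \<bar>s - t\<bar>"
    using A unfolding geodesic_segment_def by blast
  define T where "T = {t \<in> {0..l}. \<exists>r\<in>C. d (\<gamma> t) r \<le> \<delta>}"
  have "0 \<in> T"
    using \<gamma> \<open>y \<in> C\<close> \<open>0 \<le> \<delta>\<close> iso[of 0 0] by (auto simp: T_def intro!: bexI[of _ y])
  have bdd: "bdd_above T"
    by (rule bdd_aboveI[of _ l]) (simp add: T_def)
  obtain t where t: "t \<in> T" "Sup T - 1 / 2 < t"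
    using less_cSup_iff[of T "Sup T - 1 / 2"] \<open>0 \<in> T\<close> bdd by auto
  then obtain r where r: "t \<in> {0..l}" "r \<in> C" "d (\<gamma> t) r \<le> \<delta>"
    by (auto simp: T_def)
  have "t \<le> Sup T"
    using t(1) bdd by (rule cSup_upper)
  have "\<exists>q\<in>B. d (\<gamma> t) q \<le> \<delta> + 1"
  proof (cases "l \<le> t + 1")
    case True
    then have "d (\<gamma> t) z \<le> \<delta> + 1"
      using iso[of t l] r \<gamma> \<open>0 \<le> \<delta>\<close> by auto
    then show ?thesis
      using \<open>z \<in> B\<close> by blast
  next
    case False
    let ?u = "t + 1"
    have u: "?u \<in> {0..l}"
      using False r by auto
    have "?u \<notin> T"
      using cSup_upper[OF _ bdd, of ?u] t(2) by fastforce
    then obtain q where q: "q \<in> B" "d (\<gamma> ?u) q \<le> \<delta>"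
      using slim[of "\<gamma> ?u"] u \<gamma> by (auto simp: T_def)
    have "d (\<gamma> t) q \<le> d (\<gamma> t) (\<gamma> ?u) + d (\<gamma> ?u) q"
    proof (rule triangle)
      show "\<gamma> t \<in> M" "\<gamma> ?u \<in> M"
        using u r(1) \<gamma>(2) by blast+
    qed (use q BC in blast)
    then show ?thesis
      using iso[of t ?u] u r q by (intro bexI[of _ q]) auto
  qed
  then show ?thesis
    using that[of "\<gamma> t"] r \<gamma> by fastforce
qed

lemma dist_geodesic_le_gromov_product:
  assumes A: "geodesic_segment M d y z A" and B: "geodesic_segment M d z x B"
    and C: "geodesic_segment M d y x C" and "0 \<le> \<delta>"
    and slim: "\<And>p. p \<in> A \<Longrightarrow> \<exists>q\<in>B \<union> C. d p q \<le> \<delta>"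
  obtains p where "p \<in> A" "d x p \<le> gromov_product d x y z + 2 * (\<delta> + 1)"
proof -
  have BC: "B \<subseteq> M" "C \<subseteq> M"
    using geodesic_segment_point(1)[OF B] geodesic_segment_point(1)[OF C] by auto
  obtain p q r where pqr: "p \<in> A" "q \<in> B" "r \<in> C" "d p q \<le> \<delta> + 1" "d p r \<le> \<delta> + 1"
    using slim_point_near_both[OF A geodesic_segment_ends(1)[OF C] geodesic_segment_ends(1)[OF B]
      \<open>0 \<le> \<delta>\<close> slim BC] by blast
  have p: "p \<in> M" "d y p + d p z = d y z"
    using geodesic_segment_point[OF A pqr(1)] by auto
  have q: "q \<in> M" "d z q + d q x = d z x"
    using geodesic_segment_point[OF B pqr(2)] by auto
  have r: "r \<in> M" "d y r + d r x = d y x"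
    using geodesic_segment_point[OF C pqr(3)] by auto
  have xyz: "x \<in> M" "y \<in> M" "z \<in> M"
    using geodesic_segment_ends[OF B] geodesic_segment_ends[OF C]
      geodesic_segment_point(1)[OF B] geodesic_segment_point(1)[OF C] by auto
  have "d p x \<le> d p q + d q x" "d z p \<le> d z q + d q p" "d p x \<le> d p r + d r x"
    "d y p \<le> d y r + d r p"
    using triangle p q r xyz by auto
  then have "d x p \<le> gromov_product d x y z + 2 * (\<delta> + 1)"
    unfolding gromov_product_def
    using pqr(4,5) p(2) q(2) r(2) commute[of q p] commute[of r p] commute[of z p] commute[of x p]
      commute[of x y] commute[of x z] by argo
  then show ?thesis
    using that pqr by blast
qed

end

text \<open>
  In a slim triangle the Gromov product of two points is their geodesic's distance from the base
  point up to a constant. A point of the side from \<open>x\<close> to \<open>z\<close> that is as near to \<open>w\<close> as this product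
  is also near another side, whose distance from \<open>w\<close> is at least the product of its ends.
\<close>

theorem gromov_hyperbolic_four_point:
  assumes "gromov_hyperbolic S d"
  obtains \<delta> where "0 \<le> \<delta>" "\<And>w x y z. w \<in> S \<Longrightarrow> x \<in> S \<Longrightarrow> y \<in> S \<Longrightarrow> z \<in> S \<Longrightarrow>
    min (gromov_product d w x y) (gromov_product d w y z) - \<delta> \<le> gromov_product d w x z"
proof -
  interpret Metric_space S d
    using assms by (simp add: gromov_hyperbolic_def)
  have geo: "\<exists>A. geodesic_segment S d x y A" if "x \<in> S" "y \<in> S" for x y
    using assms that by (simp add: gromov_hyperbolic_def)
  obtain \<delta>\<^sub>0 where slim\<^sub>0: "\<And>x y z A B C p. geodesic_segment S d x y A \<Longrightarrow>
      geodesic_segment S d y z B \<Longrightarrow> geodesic_segment S d x z C \<Longrightarrow> p \<in> A \<Longrightarrow>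
      \<exists>q\<in>B \<union> C. d p q \<le> \<delta>\<^sub>0"
    using assms unfolding gromov_hyperbolic_def by meson
  define \<delta> where "\<delta> = max \<delta>\<^sub>0 0"
  have slim: "\<exists>q\<in>B \<union> C. d p q \<le> \<delta>"
    if "geodesic_segment S d x y A" "geodesic_segment S d y z B" "geodesic_segment S d x z C"
      "p \<in> A" for x y z A B C p
    using slim\<^sub>0[OF that] by (auto simp: \<delta>_def max_def intro: order_trans)
  have "0 \<le> \<delta>"
    by (simp add: \<delta>_def)
  have "min (gromov_product d w x y) (gromov_product d w y z) - (3 * \<delta> + 2)
      \<le> gromov_product d w x z"
    if w: "w \<in> S" and x: "x \<in> S" and y: "y \<in> S" and z: "z \<in> S" for w x y z
  proof -
    obtain A B C where ABC: "geodesic_segment S d x z A" "geodesic_segment S d z w B"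
        "geodesic_segment S d x w C"
      using geo w x y z by meson
    obtain p where p: "p \<in> A" "d w p \<le> gromov_product d w x z + 2 * (\<delta> + 1)"
      using dist_geodesic_le_gromov_product[OF ABC \<open>0 \<le> \<delta>\<close> slim[OF ABC]] by blast
    obtain D E where DE: "geodesic_segment S d z y D" "geodesic_segment S d x y E"
      using geo w x y z by meson
    obtain q where q: "q \<in> D \<union> E" "d p q \<le> \<delta>"
      using slim[OF ABC(1) DE p(1)] by blast
    have pq: "p \<in> S" "q \<in> S"
      using geodesic_segment_point(1)[OF ABC(1) p(1)] q(1)
        geodesic_segment_point(1)[OF DE(1)] geodesic_segment_point(1)[OF DE(2)] by auto
    have "gromov_product d w x y \<le> d w q \<or> gromov_product d w z y \<le> d w q"
      using q(1) gromov_product_le_dist_geodesic[OF DE(1) _ w z y]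
        gromov_product_le_dist_geodesic[OF DE(2) _ w x y] by auto
    moreover have "d w q \<le> d w p + d p q"
      using triangle w pq by blast
    moreover have "gromov_product d w z y = gromov_product d w y z"
      using commute by (simp add: gromov_product_def)
    ultimately show ?thesis
      using p(2) q(2) by (auto simp: min_def)
  qed
  then show ?thesis
    using that[of "3 * \<delta> + 2"] \<open>0 \<le> \<delta>\<close> by simp
qed

text \<open>
  If \<open>g\<close> and \<open>h\<close> pointed in different directions, then \<open>f = g\<^sup>-\<^sup>1 h\<close> would start like \<open>g\<^sup>-\<^sup>1\<close>,
  and its inverse like \<open>h\<^sup>-\<^sup>1\<close>. As none of the three is axial, each follows its own inverse for half
  of its length, so the chain \<open>g\<close>, \<open>g\<^sup>-\<^sup>1\<close>, \<open>f\<close>, \<open>f\<^sup>-\<^sup>1\<close>, \<open>h\<^sup>-\<^sup>1\<close>, \<open>h\<close> shows that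
  \<open>g\<close> and \<open>h\<close> do run together.
\<close>

lemma (in hyperbolic_length) gp_ge_half_if_not_axial:
  assumes na: "\<And>g. \<not> axial g" and g: "g \<in> carrier G" and h: "h \<in> carrier G"
  shows "min (\<rho> g) (\<rho> h) / 2 - (6 * \<delta> + 1 / 2) \<le> gp g h"
proof (rule ccontr)
  assume small: "\<not> ?thesis"
  have na': "\<rho> x / 2 - (2 * \<delta> + 1 / 2) \<le> gp (inv x) x" if "x \<in> carrier G" for x
    using na[of x] that by (simp add: axial_def)
  define f where "f = inv g \<otimes> h"
  have f: "f \<in> carrier G"
    using g h by (simp add: f_def)
  have inv_f: "inv f = inv h \<otimes> g"
    using g h by (simp add: f_def inv_mult_group)
  have 1: "\<rho> g / 2 - (2 * \<delta> + 1 / 2) \<le> gp g (inv g)"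
    using na'[OF g] gp_commute g by simp
  have 2: "gp (inv g) f = \<rho> g - gp g h"
    using gp_mult_left[of "inv g" h] gp_commute[of "inv g" f] g h f
    by (simp add: f_def length_inv)
  have 3: "(\<rho> g + \<rho> h) / 2 - gp g h - (2 * \<delta> + 1 / 2) \<le> gp f (inv f)"
    using na'[OF f] length_mult_gp[of "inv g" h] gp_commute[of f "inv f"] g h f
    by (simp add: f_def length_inv field_simps)
  have 4: "gp (inv f) (inv h) = \<rho> h - gp g h"
    using gp_mult_left[of "inv h" g] gp_commute[of g h] g h by (simp add: inv_f length_inv)
  have 5: "\<rho> h / 2 - (2 * \<delta> + 1 / 2) \<le> gp (inv h) h"
    by (rule na'[OF h])
  have "min (gp g (inv g)) (gp (inv g) h) - \<delta> \<le> gp g h"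
    "min (gp (inv g) f) (gp f h) - \<delta> \<le> gp (inv g) h"
    "min (gp f (inv f)) (gp (inv f) h) - \<delta> \<le> gp f h"
    "min (gp (inv f) (inv h)) (gp (inv h) h) - \<delta> \<le> gp (inv f) h"
    using g h f by (auto intro!: hyperbolicity)
  note step = this
  define m where "m = min (\<rho> g) (\<rho> h)"
  have m: "m \<le> \<rho> g" "m \<le> \<rho> h" "gp g h < m / 2 - (6 * \<delta> + 1 / 2)"
    using small by (auto simp: m_def)
  have inv_f_h: "m / 2 - (3 * \<delta> + 1 / 2) \<le> gp (inv f) h"
    using step(4) 4 5 m delta_nonneg by linarith
  have "m / 2 - (4 * \<delta> + 1 / 2) \<le> gp f h"
  proof -
    have "m \<le> (\<rho> g + \<rho> h) / 2"
      using m by simp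
    then have "m / 2 - (3 * \<delta> + 1 / 2) \<le> gp f (inv f)"
      using 3 m(3) delta_nonneg by linarith
    then show ?thesis
      using inv_f_h step(3) by linarith
  qed
  then have "m / 2 - (5 * \<delta> + 1 / 2) \<le> gp (inv g) h"
    using step(2) 2 m delta_nonneg by linarith
  then have "m / 2 - (6 * \<delta> + 1 / 2) \<le> gp g h"
    using step(1) 1 m delta_nonneg by linarith
  then show False
    using m by simp
qed

locale isometric_hyperbolic_action = group G for G (structure) +
  fixes S :: "'s set" and d :: "'s \<Rightarrow> 's \<Rightarrow> real" and \<phi> :: "'a \<Rightarrow> 's \<Rightarrow> 's" and \<delta> :: real
  assumes metric: "Metric_space S d"
    and action: "isometric_action G S d \<phi>"
    and geodesic: "x \<in> S \<Longrightarrow> y \<in> S \<Longrightarrow> \<exists>A. geodesic_segment S d x y A"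
    and delta: "0 \<le> \<delta>"
    and four_point: "w \<in> S \<Longrightarrow> x \<in> S \<Longrightarrow> y \<in> S \<Longrightarrow> z \<in> S \<Longrightarrow>
      min (gromov_product d w x y) (gromov_product d w y z) - \<delta> \<le> gromov_product d w x z"
begin

sublocale Metric_space S d
  by (rule metric)

sublocale group_action G S \<phi>
  using action by (simp add: isometric_action_def)

lemma act_closed [simp]: "g \<in> carrier G \<Longrightarrow> x \<in> S \<Longrightarrow> \<phi> g x \<in> S"
  using element_image by blast

lemma act_one [simp]: "x \<in> S \<Longrightarrow> \<phi> \<one> x = x"
  using id_eq_one by (metis restrict_apply')

lemma act_isometry: "g \<in> carrier G \<Longrightarrow> x \<in> S \<Longrightarrow> y \<in> S \<Longrightarrow> d (\<phi> g x) (\<phi> g y) = d x y"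
  using action by (simp add: isometric_action_def)

lemma act_inv_cancel:
  assumes "g \<in> carrier G" "x \<in> S"
  shows "\<phi> g (\<phi> (inv g) x) = x" "\<phi> (inv g) (\<phi> g x) = x"
  using assms composition_rule[of x g "inv g"] composition_rule[of x "inv g" g] by auto

lemma dist_act_inv:
  assumes "g \<in> carrier G" "x \<in> S" "y \<in> S"
  shows "d x (\<phi> (inv g) y) = d (\<phi> g x) y"
  using act_isometry[of g x "\<phi> (inv g) y"] assms by (simp add: act_inv_cancel)

definition displacement :: "'s \<Rightarrow> 'a \<Rightarrow> real" where
  "displacement x g = d x (\<phi> g x)"

lemma length_product_displacement:
  assumes "x \<in> S" "g \<in> carrier G" "h \<in> carrier G"
  shows "length_product G (displacement x) g h = gromov_product d x (\<phi> g x) (\<phi> h x)"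
  using assms
  by (simp add: length_product_def gromov_product_def displacement_def composition_rule dist_act_inv)

lemma hyperbolic_length_displacement:
  assumes x: "x \<in> S"
  shows "hyperbolic_length G (displacement x) \<delta>"
proof (rule hyperbolic_length.intro[OF group_axioms], unfold_locales)
  show "displacement x \<one> = 0"
    using x by (simp add: displacement_def)
  show "displacement x (inv g) = displacement x g" if "g \<in> carrier G" for g
    using that x commute by (simp add: displacement_def dist_act_inv)
  show "displacement x (g \<otimes> h) \<le> displacement x g + displacement x h"
    if "g \<in> carrier G" "h \<in> carrier G" for g h
    using that x triangle[of x "\<phi> g x" "\<phi> g (\<phi> h x)"]
    by (simp add: displacement_def composition_rule act_isometry)
  show "min (length_product G (displacement x) f g) (length_product G (displacement x) g h) - \<delta>
      \<le> length_product G (displacement x) f h"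
    if "f \<in> carrier G" "g \<in> carrier G" "h \<in> carrier G" for f g h
    using that x by (simp add: length_product_displacement four_point)
qed (rule delta)

lemma acylindrical_length_displacement:
  assumes x: "x \<in> S" and acyl: "acylindrical G S d \<phi>"
  shows "hyperbolic_length.acylindrical_length G (displacement x)"
proof -
  interpret L: hyperbolic_length G "displacement x" \<delta>
    by (rule hyperbolic_length_displacement[OF x])
  have eq: "{g \<in> carrier G. displacement x g \<le> \<epsilon> \<and> displacement x (inv z \<otimes> g \<otimes> z) \<le> \<epsilon>} =
      {g \<in> carrier G. d x (\<phi> g x) \<le> \<epsilon> \<and> d (\<phi> z x) (\<phi> g (\<phi> z x)) \<le> \<epsilon>}"
    if "z \<in> carrier G" for z \<epsilon>
  proof -
    have "displacement x (inv z \<otimes> g \<otimes> z) = d (\<phi> z x) (\<phi> g (\<phi> z x))" if "g \<in> carrier G" for g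
      using that \<open>z \<in> carrier G\<close> x
      by (simp add: displacement_def composition_rule dist_act_inv m_assoc)
    then show ?thesis
      by (auto simp: displacement_def)
  qed
  show ?thesis
    unfolding L.acylindrical_length_def
  proof (intro allI impI)
    fix \<epsilon> :: real assume "0 < \<epsilon>"
    then obtain R and N :: nat where RN: "\<And>x y. x \<in> S \<Longrightarrow> y \<in> S \<Longrightarrow> R \<le> d x y \<Longrightarrow>
        finite {g \<in> carrier G. d x (\<phi> g x) \<le> \<epsilon> \<and> d y (\<phi> g y) \<le> \<epsilon>} \<and>
        card {g \<in> carrier G. d x (\<phi> g x) \<le> \<epsilon> \<and> d y (\<phi> g y) \<le> \<epsilon>} \<le> N"
      using acyl unfolding acylindrical_def by meson
    show "\<exists>R (N::nat). \<forall>z\<in>carrier G. R \<le> displacement x z \<longrightarrow>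
       finite {g \<in> carrier G. displacement x g \<le> \<epsilon> \<and> displacement x (inv z \<otimes> g \<otimes> z) \<le> \<epsilon>} \<and>
       card {g \<in> carrier G. displacement x g \<le> \<epsilon> \<and> displacement x (inv z \<otimes> g \<otimes> z) \<le> \<epsilon>} \<le> N"
    proof (intro exI ballI impI)
      fix z assume z: "z \<in> carrier G" and "R \<le> displacement x z"
      then show "finite {g \<in> carrier G. displacement x g \<le> \<epsilon> \<and>
          displacement x (inv z \<otimes> g \<otimes> z) \<le> \<epsilon>} \<and>
        card {g \<in> carrier G. displacement x g \<le> \<epsilon> \<and> displacement x (inv z \<otimes> g \<otimes> z) \<le> \<epsilon>} \<le> N"
        unfolding eq[OF z] using RN[of x "\<phi> z x"] x by (simp add: displacement_def)
    qed
  qed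
qed

text \<open>
  Suppose that \<open>f\<close> moves \<open>x\<close> directly away from \<open>p\<close>, and that \<open>p\<close> is almost in the same direction
  from \<open>x\<close> as its image under the inverse of \<open>f\<close>. Then the inverse moves \<open>x\<close> towards \<open>p\<close>, so
  \<open>f\<close> translates \<open>x\<close> along a line and would be axial at \<open>x\<close> if the displacement were large.
\<close>

lemma displacement_le_if_not_axial:
  assumes x: "x \<in> S" and p: "p \<in> S" and f: "f \<in> carrier G"
    and na: "\<not> hyperbolic_length.axial G (displacement x) \<delta> f"
    and far: "3 * \<delta> < gromov_product d x p (\<phi> (inv f) p)"
    and behind: "gromov_product d x p (\<phi> f x) \<le> \<delta>"
  shows "d x (\<phi> f x) \<le> 8 * \<delta> + 1"
proof -
  interpret L: hyperbolic_length G "displacement x" \<delta>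
    by (rule hyperbolic_length_displacement[OF x])
  let ?\<tau> = "d x (\<phi> f x)" and ?y = "\<phi> (inv f) x" and ?p = "\<phi> (inv f) p"
  have S: "?y \<in> S" "?p \<in> S" "\<phi> f x \<in> S"
    using x p f by auto
  have "?\<tau> < 2 * gromov_product d x ?y (\<phi> f x) + 4 * \<delta> + 1"
    using na f x by (simp add: L.axial_def length_product_displacement) (simp add: displacement_def)
  moreover have "gromov_product d x ?p ?y = ?\<tau> - gromov_product d x p (\<phi> f x)"
    using x p f act_isometry[of "inv f" p x] commute
    by (simp add: gromov_product_def dist_act_inv field_simps)
  moreover have "min (gromov_product d x p ?p) (gromov_product d x ?p ?y) - \<delta>
      \<le> gromov_product d x p ?y"
    "min (gromov_product d x p ?y) (gromov_product d x ?y (\<phi> f x)) - \<delta>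
      \<le> gromov_product d x p (\<phi> f x)"
    using four_point x p S by auto
  ultimately show ?thesis
    using far behind delta by (simp add: min_def split: if_splits)
qed

text \<open>
  Without axial elements all orbit points that are far away lie in the same direction, so the
  group acts as if it fixed a boundary point. Given finitely many elements, take a long geodesic
  in this direction. Points on it that are neither near its beginning nor beyond its
  first half satisfy the conditions of \<open>displacement_le_if_not_axial\<close> with one of the two ends
  as \<open>p\<close>, so all the given elements move them by a constant that depends on \<open>\<delta>\<close> only. Two such
  points at distance \<open>R\<close> contradict acylindricity.
\<close>

lemma ex_axial:
  assumes "S \<noteq> {}" and acyl: "acylindrical G S d \<phi>"
    and unbounded: "\<And>x. x \<in> S \<Longrightarrow> \<not> mbounded (orbit G \<phi> x)"
  shows "\<exists>x\<in>S. \<exists>h. hyperbolic_length.axial G (displacement x) \<delta> h"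
proof (rule ccontr)
  assume "\<not> ?thesis"
  then have na: "\<And>x h. x \<in> S \<Longrightarrow> \<not> hyperbolic_length.axial G (displacement x) \<delta> h"
    by blast
  obtain o\<^sub>0 where o: "o\<^sub>0 \<in> S"
    using \<open>S \<noteq> {}\<close> by blast
  interpret L: hyperbolic_length G "displacement o\<^sub>0" \<delta>
    by (rule hyperbolic_length_displacement[OF o])
  let ?\<rho> = "displacement o\<^sub>0"
  have large: "\<exists>g\<in>carrier G. r < ?\<rho> g" for r
  proof (rule ccontr)
    assume "\<not> ?thesis"
    then have "orbit G \<phi> o\<^sub>0 \<subseteq> mcball o\<^sub>0 r"
      using o by (auto simp: orbit_def displacement_def)
    then show False
      using unbounded[OF o] by (auto simp: mbounded_def)
  qed
  have "infinite (carrier G)"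
  proof
    assume "finite (carrier G)"
    then have "?\<rho> g \<le> Max (?\<rho> ` carrier G)" if "g \<in> carrier G" for g
      using that by simp
    then show False
      using large[of "Max (?\<rho> ` carrier G)"] by force
  qed
  define \<epsilon> where "\<epsilon> = 8 * \<delta> + 1"
  have "0 < \<epsilon>"
    using delta by (simp add: \<epsilon>_def)
  then obtain R and N :: nat where R: "0 < R" and RN: "\<And>x y. x \<in> S \<Longrightarrow> y \<in> S \<Longrightarrow> R \<le> d x y \<Longrightarrow>
      finite {g \<in> carrier G. d x (\<phi> g x) \<le> \<epsilon> \<and> d y (\<phi> g y) \<le> \<epsilon>} \<and>
      card {g \<in> carrier G. d x (\<phi> g x) \<le> \<epsilon> \<and> d y (\<phi> g y) \<le> \<epsilon>} \<le> N"
    using acyl unfolding acylindrical_def by meson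
  obtain F where F: "F \<subseteq> carrier G" "finite F" "card F = Suc N"
    using infinite_arbitrarily_large[OF \<open>infinite (carrier G)\<close>] by blast
  define A where "A = Max (?\<rho> ` F)"
  have A: "?\<rho> f \<le> A" if "f \<in> F" for f
    using that F by (simp add: A_def)
  obtain f\<^sub>0 where "f\<^sub>0 \<in> F"
    using F by fastforce
  then have A0: "0 \<le> A"
    using A[of f\<^sub>0] F L.length_nonneg[of f\<^sub>0] by (meson order_trans subsetD)
  \<comment> \<open>The two test points are at distances \<open>s\<close> and \<open>t\<close> from \<open>o\<^sub>0\<close>: far enough for the elements of \<open>F\<close>
    to move \<open>o\<^sub>0\<close> only slightly as seen from there, and before the point where the translates of
    the geodesic by \<open>F\<close> may leave it.\<close>
  define s where "s = A + 3 * \<delta> + 1"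
  define t where "t = s + R"
  obtain g where g: "g \<in> carrier G" "A + 2 * (t + 9 * \<delta> + 2) < ?\<rho> g"
    using large by blast
  define z where "z = \<phi> g o\<^sub>0"
  have z: "z \<in> S"
    using g o by (simp add: z_def)
  have dz: "d o\<^sub>0 z = ?\<rho> g"
    by (simp add: z_def displacement_def)
  obtain X where X: "geodesic_segment S d o\<^sub>0 z X"
    using geodesic o z by blast
  have st: "0 \<le> s" "s \<le> t" "t \<le> d o\<^sub>0 z"
    using A0 R delta g by (auto simp: s_def t_def dz)
  obtain x y where xy: "x \<in> X" "y \<in> X" "d o\<^sub>0 x = s" "d o\<^sub>0 y = t" "d x y = t - s"
    using geodesic_segment_points_at[OF X st] by blast
  have move: "d v (\<phi> f v) \<le> \<epsilon>" if v: "v \<in> X" "s \<le> d o\<^sub>0 v" "d o\<^sub>0 v \<le> t" and f: "f \<in> F" for v f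
  proof -
    have vS: "v \<in> S" and vz: "d o\<^sub>0 v + d v z = d o\<^sub>0 z"
      using geodesic_segment_point[OF X v(1)] by auto
    have fc: "f \<in> carrier G"
      using f F by auto
    have "gromov_product d v o\<^sub>0 z = 0"
      using vz commute by (simp add: gromov_product_def)
    then have "gromov_product d v o\<^sub>0 (\<phi> f v) \<le> \<delta> \<or> gromov_product d v (\<phi> f v) z \<le> \<delta>"
      using four_point[of v o\<^sub>0 "\<phi> f v" z] vS o z fc by (auto simp: min_def split: if_splits)
    then have "\<exists>p\<in>{o\<^sub>0, z}. gromov_product d v p (\<phi> f v) \<le> \<delta>"
      using commute by (auto simp: gromov_product_def algebra_simps)
    moreover have "3 * \<delta> < gromov_product d v p (\<phi> (inv f) p)" if p: "p \<in> {o\<^sub>0, z}" for p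
    proof (cases "p = o\<^sub>0")
      case True
      have "d v o\<^sub>0 \<le> d v (\<phi> (inv f) o\<^sub>0) + d (\<phi> (inv f) o\<^sub>0) o\<^sub>0"
        using triangle vS o fc by simp
      moreover have "d o\<^sub>0 (\<phi> (inv f) o\<^sub>0) \<le> A"
        using A[OF f] L.length_inv[OF fc] by (simp add: displacement_def)
      ultimately show ?thesis
        using True v commute[of o\<^sub>0 v] commute[of o\<^sub>0 "\<phi> (inv f) o\<^sub>0"]
        by (simp add: gromov_product_def s_def)
    next
      case False
      then have "p = z"
        using p by simp
      have "?\<rho> g \<le> ?\<rho> f + ?\<rho> (inv f \<otimes> g)"
        using L.length_mult[of f "inv f \<otimes> g"] fc g by (simp add: mult_inv_cancel)
      then have "?\<rho> g - A \<le> ?\<rho> (inv f \<otimes> g)"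
        using A[OF f] by simp
      moreover have "min (?\<rho> g) (?\<rho> (inv f \<otimes> g)) / 2 - (6 * \<delta> + 1 / 2)
          \<le> length_product G ?\<rho> g (inv f \<otimes> g)"
        using L.gp_ge_half_if_not_axial na[OF o] g fc by simp
      moreover have "length_product G ?\<rho> g (inv f \<otimes> g) = gromov_product d o\<^sub>0 z (\<phi> (inv f) z)"
        using o g fc by (simp add: length_product_displacement z_def composition_rule)
      ultimately have "t + 3 * \<delta> < gromov_product d o\<^sub>0 z (\<phi> (inv f) z)"
        using g(2) A0 by (simp add: min_def split: if_splits)
      moreover have "d o\<^sub>0 z \<le> d o\<^sub>0 v + d v z"
        "d o\<^sub>0 (\<phi> (inv f) z) \<le> d o\<^sub>0 v + d v (\<phi> (inv f) z)"
        using triangle o vS z fc by auto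
      ultimately show ?thesis
        using v(3) \<open>p = z\<close> by (simp add: gromov_product_def)
    qed
    ultimately show ?thesis
      using displacement_le_if_not_axial[OF vS _ fc na[OF vS]] o z unfolding \<epsilon>_def by blast
  qed
  let ?T = "{g \<in> carrier G. d x (\<phi> g x) \<le> \<epsilon> \<and> d y (\<phi> g y) \<le> \<epsilon>}"
  have "F \<subseteq> ?T"
    using move[of x] move[of y] xy st F by auto
  moreover have "finite ?T \<and> card ?T \<le> N"
    using geodesic_segment_point(1)[OF X] xy by (intro RN) (auto simp: t_def)
  ultimately have "card F \<le> N"
    by (meson card_mono le_trans)
  then show False
    using F by simp
qed

theorem ex_word_evading_group_element:
  assumes "S \<noteq> {}" "acylindrical G S d \<phi>" "\<forall>x\<in>S. \<not> mbounded (orbit G \<phi> x)"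
  obtains x where "x \<in> S" "\<And>C. \<exists>g\<in>carrier G. g \<noteq> \<one> \<and> (\<forall>w. set w \<subseteq> carrier G \<times> UNIV \<longrightarrow>
    (\<Sum>p\<leftarrow>w. displacement x (fst p)) \<le> C \<longrightarrow> word_value G g w = \<one> \<longrightarrow> word_value G \<one> w = \<one>)"
proof -
  obtain x h where x: "x \<in> S" and h: "hyperbolic_length.axial G (displacement x) \<delta> h"
    using ex_axial assms by blast
  interpret L: hyperbolic_length G "displacement x" \<delta>
    by (rule hyperbolic_length_displacement[OF x])
  show ?thesis
    using L.ex_word_evading_element[OF acylindrical_length_displacement[OF x assms(2)] h]
    by (intro that[OF x]) (simp add: L.word_length_def)
qed

end

section \<open>Evasive elements modulo a normal subgroup, and marked groups\<close>

lemma (in group) length_int_pow_le: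
  fixes len :: "'a \<Rightarrow> nat"
  assumes len_mult: "\<And>x y. x \<in> carrier G \<Longrightarrow> y \<in> carrier G \<Longrightarrow> len (x \<otimes> y) \<le> len x + len y"
    and len_inv: "\<And>x. x \<in> carrier G \<Longrightarrow> len (inv x) \<le> len x" and len_one: "len \<one> = 0"
    and x: "x \<in> carrier G"
  shows "len (x [^] (n :: int)) \<le> nat \<bar>n\<bar> * len x"
proof -
  have nat: "len (x [^] m) \<le> m * len x" for m :: nat
  proof (induction m)
    case (Suc m)
    then show ?case
      using len_mult[of "x [^] m" x] x by simp
  qed (simp add: len_one)
  show ?thesis
  proof (cases n)
    case (nonneg m)
    then show ?thesis
      using nat[of m] by (simp add: int_pow_int)
  next
    case (neg m)
    then have "x [^] n = inv (x [^] Suc m)"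
      using int_pow_neg_int[OF x, of "Suc m"] by simp
    then have "len (x [^] n) \<le> len (x [^] Suc m)"
      using len_inv[of "x [^] Suc m"] x by (simp del: nat_pow_Suc)
    also have "\<dots> \<le> Suc m * len x"
      by (rule nat)
    also have "Suc m = nat \<bar>n\<bar>"
      using neg by simp
    finally show ?thesis .
  qed
qed

lemma (in group) length_word_value_le:
  fixes len :: "'a \<Rightarrow> nat"
  assumes len_mult: "\<And>x y. x \<in> carrier G \<Longrightarrow> y \<in> carrier G \<Longrightarrow> len (x \<otimes> y) \<le> len x + len y"
    and len_inv: "\<And>x. x \<in> carrier G \<Longrightarrow> len (inv x) \<le> len x" and len_one: "len \<one> = 0"
    and x: "x \<in> carrier G" and w: "set w \<subseteq> carrier G \<times> UNIV"
  shows "len (word_value G x w) \<le> word_cost len w * (1 + len x)"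
  using w
proof (induction w)
  case (Cons p w)
  obtain a n where p: "p = (a, n)"
    by (cases p)
  have a: "a \<in> carrier G" "set w \<subseteq> carrier G \<times> UNIV"
    using Cons.prems p by auto
  have "len (word_value G x (p # w)) \<le> len a + len (x [^] n) + len (word_value G x w)"
    using len_mult[of "a \<otimes> x [^] n" "word_value G x w"] len_mult[of a "x [^] n"] a x
    by (simp add: p)
  also have "\<dots> \<le> len a + nat \<bar>n\<bar> * len x + word_cost len w * (1 + len x)"
    using length_int_pow_le[of len x n] len_mult len_inv len_one x Cons.IH[OF a(2)]
    by (intro add_mono) auto
  also have "\<dots> \<le> word_cost len (p # w) * (1 + len x)"
    by (simp add: p algebra_simps)
  finally show ?case .
qed (simp add: len_one)

lemma (in group_hom) word_value_hom:
  assumes "x \<in> carrier G" "set w \<subseteq> carrier G \<times> UNIV"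
  shows "word_value H (h x) (map (apfst h) w) = h (word_value G x w)"
  using assms(2)
proof (induction w)
  case (Cons p w)
  then show ?case
    using assms(1) by (cases p) (auto simp: hom_int_pow)
qed simp

context normal
begin

lemma quotient_group_hom: "group_hom G (G Mod H) ((#>) H)"
  by (intro group_hom.intro group_hom_axioms.intro is_group factorgroup_is_group r_coset_hom_Mod)

lemma r_coset_eq_one_iff: "x \<in> carrier G \<Longrightarrow> H #> x = \<one>\<^bsub>G Mod H\<^esub> \<longleftrightarrow> x \<in> H"
  using coset_join1[OF _ _ is_subgroup] coset_join2[OF _ is_subgroup]
  by (auto simp: FactGroup_def subset)

lemma word_value_quotient_eq_one_iff:
  assumes "x \<in> carrier G" "set w \<subseteq> carrier G \<times> UNIV"
  shows "word_value (G Mod H) (H #> x) (map (apfst ((#>) H)) w) = \<one>\<^bsub>G Mod H\<^esub> \<longleftrightarrow>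
    word_value G x w \<in> H"
  unfolding group_hom.word_value_hom[OF quotient_group_hom assms]
  by (rule r_coset_eq_one_iff[OF word_value_closed[OF assms]])

text \<open>
  The quotient is given the length of the shortest representative. Coefficients in the quotient
  then lift to coefficients of the same length, so that words keep their complexity.
\<close>

theorem topologizable_quotient_if_evasive:
  fixes len :: "'a \<Rightarrow> nat"
  assumes len_mult: "\<And>x y. x \<in> carrier G \<Longrightarrow> y \<in> carrier G \<Longrightarrow> len (x \<otimes> y) \<le> len x + len y"
    and len_inv: "\<And>x. x \<in> carrier G \<Longrightarrow> len (inv x) \<le> len x"
    and len_one: "len \<one> = 0"
    and ex: "\<And>K. \<exists>g\<in>carrier G - H. evasive G H len K g"
  shows "topologizable (G Mod H)"
proof -
  interpret Q: group "G Mod H"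
    by (rule factorgroup_is_group)
  interpret \<pi>: group_hom G "G Mod H" "(#>) H"
    by (rule quotient_group_hom)
  define qlen where "qlen c = (LEAST n. n \<in> len ` c)" for c
  have qlen_le: "qlen (H #> u) \<le> len u" if "u \<in> carrier G" for u
    unfolding qlen_def using rcos_self[OF that is_subgroup] by (intro Least_le) simp
  have rep: "\<exists>u\<in>carrier G. c = H #> u \<and> len u = qlen c" if c: "c \<in> carrier (G Mod H)" for c
  proof -
    obtain v where v: "v \<in> carrier G" "c = H #> v"
      using c by (auto simp: FactGroup_def RCOSETS_def)
    then have "len v \<in> len ` c"
      using rcos_self[OF _ is_subgroup] by blast
    then have "qlen c \<in> len ` c"
      unfolding qlen_def by (rule LeastI)
    then obtain u where u: "u \<in> c" "len u = qlen c"
      by auto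
    then have "H #> u = c"
      using repr_independence[OF _ v(1) is_subgroup, of u] v by simp
    moreover have "u \<in> carrier G"
      using u v r_coset_subset_G[OF subset] by blast
    ultimately show ?thesis
      using u by auto
  qed
  obtain lift where lift: "\<And>c. c \<in> carrier (G Mod H) \<Longrightarrow>
      lift c \<in> carrier G \<and> H #> lift c = c \<and> len (lift c) = qlen c"
    using bchoice[of "carrier (G Mod H)" "\<lambda>c u. u \<in> carrier G \<and> c = H #> u \<and> len u = qlen c"]
      rep by metis
  show ?thesis
  proof (rule Q.topologizable_if_evasive[of qlen])
    show "qlen (c \<otimes>\<^bsub>G Mod H\<^esub> c') \<le> qlen c + qlen c'"
      if c: "c \<in> carrier (G Mod H)" and c': "c' \<in> carrier (G Mod H)" for c c'
    proof -
      have "qlen (H #> (lift c \<otimes> lift c')) \<le> len (lift c \<otimes> lift c')"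
        using lift c c' by (intro qlen_le) simp
      also have "\<dots> \<le> qlen c + qlen c'"
        using len_mult[of "lift c" "lift c'"] lift[OF c] lift[OF c'] by simp
      also have "H #> (lift c \<otimes> lift c') = c \<otimes>\<^bsub>G Mod H\<^esub> c'"
        using \<pi>.hom_mult[of "lift c" "lift c'"] lift[OF c] lift[OF c'] by simp
      finally show ?thesis .
    qed
    show "qlen (inv\<^bsub>G Mod H\<^esub> c) \<le> qlen c" if c: "c \<in> carrier (G Mod H)" for c
    proof -
      have "qlen (H #> inv (lift c)) \<le> len (inv (lift c))"
        using lift[OF c] by (intro qlen_le) simp
      also have "\<dots> \<le> qlen c"
        using len_inv[of "lift c"] lift[OF c] by simp
      also have "H #> inv (lift c) = inv\<^bsub>G Mod H\<^esub> c"
        using \<pi>.hom_inv[of "lift c"] lift[OF c] by simp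
      finally show ?thesis .
    qed
    show "qlen \<one>\<^bsub>G Mod H\<^esub> = 0"
      using qlen_le[of \<one>] len_one \<pi>.hom_one by simp
    fix K
    obtain g where g: "g \<in> carrier G" "g \<notin> H" and ev: "evasive G H len K g"
      using ex by blast
    have "evasive (G Mod H) {\<one>\<^bsub>G Mod H\<^esub>} qlen K (H #> g)"
      unfolding evasive_def
    proof (intro allI impI)
      fix w
      assume w: "set w \<subseteq> carrier (G Mod H) \<times> UNIV" "word_cost qlen w \<le> K"
        and one: "word_value (G Mod H) (H #> g) w \<in> {\<one>\<^bsub>G Mod H\<^esub>}"
      define v where "v = map (apfst lift) w"
      have v: "set v \<subseteq> carrier G \<times> UNIV"
        using w lift by (auto simp: v_def)
      have "map (apfst ((#>) H)) v = w"
        unfolding v_def map_map by (rule map_idI) (use w lift in auto)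
      then have val: "word_value (G Mod H) (H #> x) w = \<one>\<^bsub>G Mod H\<^esub> \<longleftrightarrow> word_value G x v \<in> H"
        if "x \<in> carrier G" for x
        using word_value_quotient_eq_one_iff[OF that v] by simp
      have "word_cost len v = word_cost qlen w"
        unfolding word_cost_def v_def map_map
        by (rule arg_cong[of _ _ sum_list], rule map_cong) (use w lift in auto)
      then have "word_value G \<one> v \<in> H"
        using ev v w(2) one val[OF g(1)] unfolding evasive_def by auto
      then show "word_value (G Mod H) \<one>\<^bsub>G Mod H\<^esub> w \<in> {\<one>\<^bsub>G Mod H\<^esub>}"
        using val[of \<one>] \<pi>.hom_one by simp
    qed
    moreover have "H #> g \<noteq> \<one>\<^bsub>G Mod H\<^esub>"
      using g r_coset_eq_one_iff by simp
    ultimately show "\<exists>c\<in>carrier (G Mod H). c \<noteq> \<one>\<^bsub>G Mod H\<^esub> \<and>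
        evasive (G Mod H) {\<one>\<^bsub>G Mod H\<^esub>} qlen K c"
      using g \<pi>.hom_closed by blast
  qed
qed

end

lemma length_cons_red_le: "length (cons_red a w) \<le> Suc (length w)"
  by (cases w) auto

lemma length_reduce_le: "length (reduce w) \<le> length w"
proof (induction w)
  case (Cons a w)
  then show ?case
    using length_cons_red_le[of a "reduce w"] by (simp add: reduce_def)
qed (simp add: reduce_def)

lemma length_free_group_mult:
  "length (u \<otimes>\<^bsub>free_group k\<^esub> v) \<le> length u + length v"
  using length_reduce_le[of "u @ v"] by (simp add: free_group_def)

lemma length_free_group_inv:
  assumes u: "u \<in> carrier (free_group k)"
  shows "length (inv\<^bsub>free_group k\<^esub> u) \<le> length u"
proof -
  interpret group "free_group k"
    by (rule group_free_group)
  define v where "v = reduce (rev (map inv_letter u))"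
  have red: "reduced_word u"
    using u by (simp add: free_group_def)
  have "set v \<subseteq> inv_letter ` set u"
    using set_reduce[of "rev (map inv_letter u)"] by (simp add: v_def)
  also have "\<dots> \<subseteq> {..<k} \<times> UNIV"
    using u by (auto simp: free_group_def inv_letter_def)
  finally have v: "v \<in> carrier (free_group k)"
    by (simp add: v_def free_group_def reduced_reduce)
  have "v \<otimes>\<^bsub>free_group k\<^esub> u = []"
    using foldr_foldr[of "[]" u "rev (map inv_letter u)"] foldr_inv_word[of "[]" u]
      reduce_reduced[OF red] red
    by (simp add: v_def free_group_def reduce_append reduce_def)
  then have "inv\<^bsub>free_group k\<^esub> u = v"
    using u v by (intro inv_equality) (simp_all add: free_group_def)
  then show ?thesis
    using length_reduce_le[of "rev (map inv_letter u)"] by (simp add: v_def)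
qed

lemma length_free_group_one: "length \<one>\<^bsub>free_group k\<^esub> = 0"
  by (simp add: free_group_def)

lemma marked_dist_ge:
  assumes "w \<in> sym_diff M N"
  shows "1 / real (length w) \<le> marked_dist M N"
proof -
  have "M \<noteq> N"
    using assms by blast
  then show ?thesis
    by (rule marked_dist_greatest) (use assms in blast)
qed

lemma marked_groups_near_agree:
  assumes "M \<in> marked_groups k" "N \<in> marked_groups k" "marked_dist M N < 1 / (real L + 1)"
    and "length w \<le> L"
  shows "w \<in> M \<longleftrightarrow> w \<in> N"
proof (rule ccontr)
  assume "\<not> ?thesis"
  then have w: "w \<in> sym_diff M N"
    by blast
  then have "w \<noteq> []"
    using Nil_in_marked_group assms(1,2) by blast
  then have "1 / (real L + 1) \<le> 1 / real (length w)"
    using assms(4) by (intro divide_left_mono) auto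
  then show False
    using marked_dist_ge[OF w] assms(3) by linarith
qed

definition evasive_groups :: "nat \<Rightarrow> nat \<Rightarrow> word set set" where
  "evasive_groups k K = {N \<in> marked_groups k.
     \<exists>g\<in>carrier (free_group k) - N. evasive (free_group k) N length K g}"

text \<open>
  Whether \<open>g\<close> is evasive for complexity \<open>K\<close> modulo \<open>N\<close> depends only on which elements of length
  at most \<open>(K + 1) (1 + |g|)\<close> belong to \<open>N\<close>, and nearby normal subgroups agree on these.
\<close>

lemma openin_evasive_groups: "openin (marked_topology k) (evasive_groups k K)"
proof -
  interpret group "free_group k"
    by (rule group_free_group)
  interpret Metric_space "marked_groups k" marked_dist
    by (rule Metric_space_marked_groups)
  have "\<exists>r>0. mball M r \<subseteq> evasive_groups k K" if M: "M \<in> evasive_groups k K" for M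
  proof -
    obtain g where g: "g \<in> carrier (free_group k)" "g \<notin> M"
      and ev: "evasive (free_group k) M length K g"
      using M by (auto simp: evasive_groups_def)
    define L where "L = (K + 1) * (1 + length g)"
    have "N \<in> evasive_groups k K" if N: "N \<in> mball M (1 / (real L + 1))" for N
    proof -
      have agree: "v \<in> M \<longleftrightarrow> v \<in> N" if "length v \<le> L" for v
        using N marked_groups_near_agree[OF _ _ _ that, of M k N] by auto
      have short: "length (word_value (free_group k) x w) \<le> L"
        if "x \<in> carrier (free_group k)" "length x \<le> length g"
          "set w \<subseteq> carrier (free_group k) \<times> UNIV" "word_cost length w \<le> K" for x w
      proof -
        have "length (word_value (free_group k) x w) \<le> word_cost length w * (1 + length x)"
          using that(1,3) by (intro length_word_value_le)
            (simp_all add: length_free_group_mult length_free_group_inv length_free_group_one)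
        also have "\<dots> \<le> L"
          using that(2,4) unfolding L_def by (intro mult_mono) auto
        finally show ?thesis .
      qed
      have "length g \<le> L"
        by (simp add: L_def)
      then have "g \<notin> N"
        using agree g by blast
      moreover have "evasive (free_group k) N length K g"
        unfolding evasive_def
      proof (intro allI impI)
        fix w assume w: "set w \<subseteq> carrier (free_group k) \<times> UNIV" "word_cost length w \<le> K"
          "word_value (free_group k) g w \<in> N"
        then have "word_value (free_group k) \<one>\<^bsub>free_group k\<^esub> w \<in> M"
          using ev agree[OF short[OF g(1) order_refl w(1,2)]] unfolding evasive_def by blast
        then show "word_value (free_group k) \<one>\<^bsub>free_group k\<^esub> w \<in> N"
          using agree[OF short[OF one_closed _ w(1,2)]] by (simp add: length_free_group_one)
      qed
      ultimately show ?thesis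
        using g N by (auto simp: evasive_groups_def)
    qed
    then have "mball M (1 / (real L + 1)) \<subseteq> evasive_groups k K"
      by (rule subsetI)
    moreover have "0 < 1 / (real L + 1)"
      by simp
    ultimately show ?thesis
      by (intro exI conjI)
  qed
  then show ?thesis
    unfolding marked_topology_def openin_mtopology by (auto simp: evasive_groups_def)
qed

lemma topologizable_if_evasive_groups:
  assumes "\<And>K. N \<in> evasive_groups k K"
  shows "topologizable (free_group k Mod N)"
proof -
  interpret normal N "free_group k"
    using assms[of 0] by (simp add: evasive_groups_def marked_groups_def)
  show ?thesis
  proof (rule topologizable_quotient_if_evasive[of length])
    show "\<exists>g\<in>carrier (free_group k) - N. evasive (free_group k) N length K g" for K
      using assms[of K] by (simp add: evasive_groups_def)
  qed (simp_all add: length_free_group_mult length_free_group_inv length_free_group_one)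
qed

lemma subadditive_le_length:
  fixes f :: "word \<Rightarrow> real"
  assumes mult: "\<And>u v. u \<in> carrier (free_group k) \<Longrightarrow> v \<in> carrier (free_group k) \<Longrightarrow>
      f (u \<otimes>\<^bsub>free_group k\<^esub> v) \<le> f u + f v"
    and one: "f \<one>\<^bsub>free_group k\<^esub> \<le> 0"
  obtains \<Lambda> :: real where "0 \<le> \<Lambda>" "\<And>u. u \<in> carrier (free_group k) \<Longrightarrow> f u \<le> \<Lambda> * length u"
proof -
  define \<Lambda> where "\<Lambda> = (\<Sum>a\<in>{..<k} \<times> UNIV. \<bar>f [a]\<bar>)"
  have bound: "f u \<le> \<Lambda> * length u" if "u \<in> carrier (free_group k)" for u
    using that
  proof (induction u)
    case Nil
    then show ?case
      using one by (simp add: free_group_def)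
  next
    case (Cons a u)
    have a: "a \<in> {..<k} \<times> UNIV" "[a] \<in> carrier (free_group k)" "u \<in> carrier (free_group k)"
      and red: "reduced_word (a # u)"
      using Cons.prems by (auto simp: free_group_def reduced_Cons)
    have "[a] \<otimes>\<^bsub>free_group k\<^esub> u = a # u"
      using reduce_reduced[OF red] by (simp add: free_group_def)
    then have "f (a # u) \<le> f [a] + f u"
      using mult[OF a(2,3)] by simp
    also have "f [a] \<le> \<Lambda>"
    proof -
      have "\<bar>f [a]\<bar> \<le> \<Lambda>"
        unfolding \<Lambda>_def by (rule member_le_sum[OF a(1)]) auto
      then show ?thesis
        by simp
    qed
    finally show ?case
      using Cons.IH[OF a(3)] by (simp add: algebra_simps)
  qed
  have "0 \<le> \<Lambda>"
    by (simp add: \<Lambda>_def sum_nonneg)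
  then show ?thesis
    by (rule that[OF _ bound])
qed

text \<open>
  The displacement of the base point is at most a constant times the word length, so words of
  bounded complexity have coefficients of bounded total displacement.
\<close>

lemma acylindrically_hyperbolic_evasive:
  assumes N: "N \<in> marked_groups k"
    and hyp: "acylindrically_hyperbolic TYPE('s) (free_group k Mod N)"
  shows "N \<in> evasive_groups k K"
proof -
  let ?F = "free_group k" and ?Q = "free_group k Mod N"
  interpret normal N ?F
    using N by (simp add: marked_groups_def)
  interpret \<pi>: group_hom ?F ?Q "(#>\<^bsub>?F\<^esub>) N"
    by (rule quotient_group_hom)
  obtain S :: "'s set" and d \<phi> where S: "S \<noteq> {}" "gromov_hyperbolic S d"
      "isometric_action ?Q S d \<phi>" "acylindrical ?Q S d \<phi>" "non_elementary ?Q S d \<phi>"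
    using hyp unfolding acylindrically_hyperbolic_def by blast
  obtain \<delta> where \<delta>: "0 \<le> \<delta>" "\<And>w x y z. w \<in> S \<Longrightarrow> x \<in> S \<Longrightarrow> y \<in> S \<Longrightarrow> z \<in> S \<Longrightarrow>
      min (gromov_product d w x y) (gromov_product d w y z) - \<delta> \<le> gromov_product d w x z"
    by (rule gromov_hyperbolic_four_point[OF S(2)]) (rule that)
  interpret A: isometric_hyperbolic_action ?Q S d \<phi> \<delta>
    by (intro isometric_hyperbolic_action.intro isometric_hyperbolic_action_axioms.intro
        factorgroup_is_group) (use S \<delta> in \<open>auto simp: gromov_hyperbolic_def\<close>)
  have unbounded: "\<forall>x\<in>S. \<not> A.mbounded (orbit ?Q \<phi> x)"
    using S(5) by (simp add: non_elementary_def)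
  obtain x where x: "x \<in> S" and evade: "\<And>C. \<exists>g\<in>carrier ?Q. g \<noteq> \<one>\<^bsub>?Q\<^esub> \<and>
      (\<forall>w. set w \<subseteq> carrier ?Q \<times> UNIV \<longrightarrow> (\<Sum>p\<leftarrow>w. A.displacement x (fst p)) \<le> C \<longrightarrow>
        word_value ?Q g w = \<one>\<^bsub>?Q\<^esub> \<longrightarrow> word_value ?Q \<one>\<^bsub>?Q\<^esub> w = \<one>\<^bsub>?Q\<^esub>)"
    by (rule A.ex_word_evading_group_element[OF S(1,4) unbounded]) (rule that)
  interpret L: hyperbolic_length ?Q "A.displacement x" \<delta>
    by (rule A.hyperbolic_length_displacement[OF x])
  obtain \<Lambda> :: real where \<Lambda>: "0 \<le> \<Lambda>" "\<And>u. u \<in> carrier ?F \<Longrightarrow>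
      A.displacement x (N #>\<^bsub>?F\<^esub> u) \<le> \<Lambda> * length u"
  proof (rule subadditive_le_length[of k "\<lambda>u. A.displacement x (N #>\<^bsub>?F\<^esub> u)"])
    show "A.displacement x (N #>\<^bsub>?F\<^esub> (u \<otimes>\<^bsub>?F\<^esub> v)) \<le>
        A.displacement x (N #>\<^bsub>?F\<^esub> u) + A.displacement x (N #>\<^bsub>?F\<^esub> v)"
      if "u \<in> carrier ?F" "v \<in> carrier ?F" for u v
      using that \<pi>.hom_mult[of u v] L.length_mult \<pi>.hom_closed by simp
    show "A.displacement x (N #>\<^bsub>?F\<^esub> \<one>\<^bsub>?F\<^esub>) \<le> 0"
      using L.length_one \<pi>.hom_one by simp
  qed (rule that)
  obtain c where c: "c \<in> carrier ?Q" "c \<noteq> \<one>\<^bsub>?Q\<^esub>"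
    and ev: "\<forall>w. set w \<subseteq> carrier ?Q \<times> UNIV \<longrightarrow>
      (\<Sum>p\<leftarrow>w. A.displacement x (fst p)) \<le> \<Lambda> * K \<longrightarrow> word_value ?Q c w = \<one>\<^bsub>?Q\<^esub> \<longrightarrow>
      word_value ?Q \<one>\<^bsub>?Q\<^esub> w = \<one>\<^bsub>?Q\<^esub>"
    using evade[of "\<Lambda> * K"] by blast
  obtain g where g: "g \<in> carrier ?F" "c = N #>\<^bsub>?F\<^esub> g"
    using c(1) by (auto simp: FactGroup_def RCOSETS_def)
  have "g \<notin> N"
    using c(2) g r_coset_eq_one_iff by simp
  moreover have "evasive ?F N length K g"
    unfolding evasive_def
  proof (intro allI impI)
    fix w assume w: "set w \<subseteq> carrier ?F \<times> UNIV" "word_cost length w \<le> K" "word_value ?F g w \<in> N"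
    define v where "v = map (apfst ((#>\<^bsub>?F\<^esub>) N)) w"
    have v: "set v \<subseteq> carrier ?Q \<times> UNIV"
      using w(1) \<pi>.hom_closed by (auto simp: v_def)
    have "(\<Sum>p\<leftarrow>v. A.displacement x (fst p)) \<le> \<Lambda> * word_cost length w"
      using w(1) unfolding v_def
    proof (induction w)
      case (Cons p w)
      have "A.displacement x (N #>\<^bsub>?F\<^esub> fst p) \<le> \<Lambda> * length (fst p)"
        using Cons.prems by (intro \<Lambda>(2)) auto
      also have "\<dots> \<le> \<Lambda> * (length (fst p) + nat \<bar>snd p\<bar>)"
        using \<Lambda>(1) by (intro mult_left_mono) auto
      finally show ?case
        using Cons by (simp add: distrib_left)
    qed simp
    also have "\<dots> \<le> \<Lambda> * K"
      using w(2) \<Lambda>(1) by (intro mult_left_mono) auto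
    finally have "word_value ?Q c v = \<one>\<^bsub>?Q\<^esub> \<longrightarrow> word_value ?Q \<one>\<^bsub>?Q\<^esub> v = \<one>\<^bsub>?Q\<^esub>"
      using ev v by blast
    then show "word_value ?F \<one>\<^bsub>?F\<^esub> w \<in> N"
      using word_value_quotient_eq_one_iff[OF g(1) w(1)] w(3) \<pi>.hom_one
        word_value_quotient_eq_one_iff[OF _ w(1), of "\<one>\<^bsub>?F\<^esub>"] g by (simp add: v_def)
  qed
  ultimately show ?thesis
    using N g by (auto simp: evasive_groups_def)
qed

theorem theorem1p6:
  fixes k :: nat and \<S> :: "word set set"
  assumes "\<S> \<subseteq> marked_groups k"
    and "\<And>N. N \<in> \<S> \<Longrightarrow> acylindrically_hyperbolic TYPE('s) (free_group k Mod N)"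
  shows "generic_in (subtopology (marked_topology k) (marked_topology k closure_of \<S>))
           (\<lambda>N. topologizable (free_group k Mod N))"
proof -
  let ?X = "marked_topology k"
  let ?C = "?X closure_of \<S>"
  define U where "U = (\<Inter>K. evasive_groups k K)"
  have top: "topspace ?X = marked_groups k"
    using Metric_space.topspace_mtopology[OF Metric_space_marked_groups]
    by (simp add: marked_topology_def)
  have \<S>: "\<S> \<subseteq> U"
    using acylindrically_hyperbolic_evasive assms unfolding U_def by blast
  have "gdelta_in ?X U"
    unfolding U_def by (rule gdelta_in_Inter) (auto intro: open_imp_gdelta_in openin_evasive_groups)
  then have "gdelta_in (subtopology ?X ?C) (?C \<inter> U)"
    by (auto simp: gdelta_in_subtopology)
  moreover have "subtopology ?X ?C closure_of (?C \<inter> U) = topspace (subtopology ?X ?C)"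
  proof -
    have "\<S> \<subseteq> ?C \<inter> U"
      using \<S> closure_of_subset[of \<S> ?X] assms(1) top by auto
    then have "?C \<subseteq> ?X closure_of (?C \<inter> U)"
      by (rule closure_of_mono)
    then show ?thesis
      by (simp add: closure_of_subtopology Int_absorb1 Int_absorb2 Int_left_absorb
          closure_of_subset_topspace)
  qed
  moreover have "topologizable (free_group k Mod N)" if "N \<in> ?C \<inter> U" for N
    using that by (intro topologizable_if_evasive_groups) (simp add: U_def)
  ultimately show ?thesis
    unfolding generic_in_def by blast
qed

end
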